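(* Let $N\ge 1$ be an integer and let $p$ be a real number with $N<p<\infty$. Then for all $u\in C_c^\infty(\mathbb{R}^N\setminus\{o\})$, $$\max\left\{\int_0^\infty r^{N-1}\sup_{0<s\le r}\int_{\mathbb{S}^{N-1}}\frac{|u(s\sigma)|^p}{r^p}\,d\sigma\,dr,\ \int_0^\infty r^{N-1}\sup_{r\le s<\infty}\int_{\mathbb{S}^{N-1}}\frac{|u(s\sigma)|^p}{s^p}\,d\sigma\,dr\right\}\le\left|\frac{p}{N-p}\right|^p\int_{\mathbb{R}^N}\left|\frac{x}{|x|}\cdot\nabla u(x)\right|^p dx .$$ Moreover the constant $\left|\frac{p}{N-p}\right|^p$ is sharp: if $C<\left|\frac{p}{N-p}\right|^p$, then the inequality obtained by replacing $\left|\frac{p}{N-p}\right|^p$ by $C$ on the right-hand side does not hold for all $u\in C_c^\infty(\mathbb{R}^N\setminus\{o\})$.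
   Context: $o$ denotes the origin of $\mathbb{R}^N$. $C_c^\infty(\mathbb{R}^N\setminus\{o\})$ is the space of real-valued smooth functions with compact support contained in $\mathbb{R}^N\setminus\{o\}$. $\mathbb{S}^{N-1}=\{x\in\mathbb{R}^N: |x|=1\}$ is the unit sphere with surface measure $d\sigma$ (counting measure on $\{-1,1\}$ when $N=1$), normalized so that $\int_{\mathbb{R}^N}f(x)\,dx=\int_0^\infty\int_{\mathbb{S}^{N-1}}f(r\sigma)\,r^{N-1}\,d\sigma\,dr$. The dot is the Euclidean scalar product, so $\frac{x}{|x|}\cdot\nabla u(x)$ is the radial derivative of $u$. *)

theory Defs
  imports "HOL-Analysis.Analysis"
begin

definition grad :: "('a::euclidean_space \<Rightarrow> real) \<Rightarrow> 'a \<Rightarrow> 'a" where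
  "grad u x = (THE D. GDERIV u x :> D)"

primrec C_differentiable :: "nat \<Rightarrow> ('a::euclidean_space \<Rightarrow> real) \<Rightarrow> bool" where
  "C_differentiable 0 u \<longleftrightarrow> continuous_on UNIV u"
| "C_differentiable (Suc k) u \<longleftrightarrow>
     (\<forall>x. u differentiable (at x)) \<and>
     (\<forall>b\<in>Basis. C_differentiable k (\<lambda>x. frechet_derivative u (at x) b))"

definition smooth :: "('a::euclidean_space \<Rightarrow> real) \<Rightarrow> bool" where
  "smooth u \<longleftrightarrow> (\<forall>k. C_differentiable k u)"

(* A function in this space is represented by its extension by 0 to the whole space:
   smoothness on the punctured space is then the same as smoothness everywhere,
   because the function vanishes in a neighbourhood of 0. *)
definition test_functions_punctured :: "('a::euclidean_space \<Rightarrow> real) set" where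
  "test_functions_punctured =
     {u. smooth u \<and> compact (closure (support_on UNIV u)) \<and> closure (support_on UNIV u) \<subseteq> - {0}}"

(* Surface measure of a Borel subset A of the unit sphere: DIM('a) times the Lebesgue measure
   of the cone {x. 0 < norm x < 1, x / norm x \<in> A}. The factor is the one forced by
   integration in polar coordinates, since the integral of r ^ (DIM('a) - 1) over (0,1)
   is 1 / DIM('a); in dimension one this is the counting measure on {-1, 1}. *)
definition sphere_measure :: "'a::euclidean_space measure" where
  "sphere_measure =
     scale_measure (of_nat DIM('a))
       (distr (restrict_space lborel (ball 0 1 - {0})) (restrict_space borel (sphere 0 1)) sgn)"

lemma sgn_measurable_sphere: "sgn \<in> restrict_space lborel (ball 0 1 - {0}) \<rightarrow>\<^sub>M restrict_space borel (sphere (0::'a::euclidean_space) 1)"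
proof (rule measurable_restrict_space2)
  show "sgn \<in> space (restrict_space lborel (ball 0 1 - {0::'a})) \<rightarrow> sphere 0 1"
    by (auto simp: space_restrict_space norm_sgn)
  show "sgn \<in> restrict_space lborel (ball 0 1 - {0::'a}) \<rightarrow>\<^sub>M borel"
    by (rule measurable_restrict_space1) auto
qed

lemma emeasure_sphere_measure:
  fixes A :: "'a::euclidean_space set"
  assumes "A \<in> sets borel" "A \<subseteq> sphere 0 1"
  shows "emeasure sphere_measure A = of_nat DIM('a) * emeasure lborel {x. 0 < norm x \<and> norm x < 1 \<and> x /\<^sub>R norm x \<in> A}"
proof -
  have A: "A \<in> sets (restrict_space borel (sphere (0::'a) 1))"
    using assms by (subst sets_restrict_space_iff) auto
  have "sgn -` A \<inter> space (restrict_space lborel (ball 0 1 - {0::'a})) = {x. 0 < norm x \<and> norm x < 1 \<and> x /\<^sub>R norm x \<in> A}"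
    by (auto simp: space_restrict_space sgn_div_norm)
  moreover have "emeasure (distr (restrict_space lborel (ball 0 1 - {0::'a})) (restrict_space borel (sphere 0 1)) sgn) A
    = emeasure lborel (sgn -` A \<inter> space (restrict_space lborel (ball 0 1 - {0::'a})))"
    unfolding emeasure_distr[OF sgn_measurable_sphere A] by (rule emeasure_restrict_space) (auto simp: space_restrict_space)
  ultimately show ?thesis unfolding sphere_measure_def by simp
qed

(* The integrals below are taken in ennreal, so that the suprema and integrals are meaningful
   without any a priori finiteness. *)

definition hardy_sup_inner :: "real \<Rightarrow> ('a::euclidean_space \<Rightarrow> real) \<Rightarrow> ennreal" where
  "hardy_sup_inner p u =
     (\<integral>\<^sup>+ r \<in> {0<..}. ennreal (r ^ (DIM('a) - 1)) *
        (SUP s \<in> {0<..r}. \<integral>\<^sup>+ \<sigma>. ennreal (\<bar>u (s *\<^sub>R \<sigma>)\<bar> powr p / r powr p) \<partial>sphere_measure) \<partial>lborel)"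

definition hardy_sup_outer :: "real \<Rightarrow> ('a::euclidean_space \<Rightarrow> real) \<Rightarrow> ennreal" where
  "hardy_sup_outer p u =
     (\<integral>\<^sup>+ r \<in> {0<..}. ennreal (r ^ (DIM('a) - 1)) *
        (SUP s \<in> {r..}. \<integral>\<^sup>+ \<sigma>. ennreal (\<bar>u (s *\<^sub>R \<sigma>)\<bar> powr p / s powr p) \<partial>sphere_measure) \<partial>lborel)"

definition radial_energy :: "real \<Rightarrow> ('a::euclidean_space \<Rightarrow> real) \<Rightarrow> ennreal" where
  "radial_energy p u = (\<integral>\<^sup>+ x. ennreal (\<bar>(x /\<^sub>R norm x) \<bullet> grad u x\<bar> powr p) \<partial>lborel)"

end

theory Submission
  imports Defs
begin

text \<open>
  Along the ray through a unit vector \<open>\<sigma>\<close> put \<open>g(t) = \<bar>\<sigma> \<cdot> \<nabla>u(t\<sigma>)\<bar>\<close> and \<open>G(s) = \<integral>\<^sub>0\<^sup>s g\<close>, so that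
  \<open>\<bar>u(s\<sigma>)\<bar> \<le> G(s)\<close>. Both integrands are then bounded by the integral over \<open>\<sigma>\<close> of
  \<open>M\<^sub>\<sigma>(r)\<^sup>p\<close> with the maximal function \<open>M\<^sub>\<sigma>(r) = sup\<^sub>s\<^sub>\<ge>\<^sub>r G(s)/s\<close>, and by Fubini it suffices to bound
  \<open>\<integral> r\<^sup>N\<^sup>-\<^sup>1 M(r)\<^sup>p dr\<close> by \<open>(p/(p-N))\<^sup>p \<integral> r\<^sup>N\<^sup>-\<^sup>1 g(r)\<^sup>p dr\<close> in one dimension. The superlevel set of \<open>M\<close> at height
  \<open>c\<close> is an interval \<open>(0,\<rho>)\<close> with \<open>G(\<rho>) \<ge> c\<rho>\<close>; integrating the derivative of \<open>r\<^sup>N\<^sup>-\<^sup>1 G(r)\<close> over it, and then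
  integrating against \<open>c\<^sup>p\<^sup>-\<^sup>2 dc\<close> gives a bound in terms of \<open>\<integral> r\<^sup>N\<^sup>-\<^sup>1 g M\<^sup>p\<^sup>-\<^sup>1\<close>, and Young's inequality concludes.

  Sharpness is tested on \<open>u(x) = \<bar>x\<bar>\<^sup>\<beta> f(\<epsilon> ln \<bar>x\<bar>)\<close> with \<open>\<beta> = (p-N)/p\<close> and a fixed smooth bump \<open>f\<close>. The
  substitution \<open>t = \<epsilon> ln r\<close> turns the two sides into multiples of \<open>\<integral> \<bar>f\<bar>\<^sup>p\<close> and \<open>\<integral> \<bar>\<beta>f + \<epsilon>f'\<bar>\<^sup>p\<close>, and
  \<open>\<epsilon>\<close> tends to 0.
\<close>


subsection \<open>A weighted Hardy inequality for a maximal function\<close>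

text \<open>After Tonelli the inner integral is that of \<open>c powr a\<close> over
  \<open>(0, M r)\<close>, and \<open>-1 < a\<close> makes it converge at 0. It is used with
  \<open>a = p - 1\<close> and \<open>a = p - 2\<close>.\<close>

lemma layer_cake_powr:
  fixes F :: "real \<Rightarrow> ennreal" and M :: "real \<Rightarrow> real"
  assumes [measurable]: "F \<in> borel_measurable borel" "M \<in> borel_measurable borel"
    and "\<And>r. 0 \<le> M r" and a: "-1 < a"
  shows "(\<integral>\<^sup>+c. ennreal (c powr a) * indicator {0<..} c * (\<integral>\<^sup>+r. F r * indicator {r. c < M r} r \<partial>lborel) \<partial>lborel)
    = (\<integral>\<^sup>+r. F r * ennreal (M r powr (a + 1) / (a + 1)) \<partial>lborel)"
proof -
  have "(\<integral>\<^sup>+c. ennreal (c powr a) * indicator {0<..} c * (\<integral>\<^sup>+r. F r * indicator {r. c < M r} r \<partial>lborel) \<partial>lborel)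
     = (\<integral>\<^sup>+c. (\<integral>\<^sup>+r. ennreal (c powr a) * indicator {0<..} c * (F r * indicator {r. c < M r} r) \<partial>lborel) \<partial>lborel)"
    by (subst nn_integral_cmult) auto
  also have "\<dots> = (\<integral>\<^sup>+r. (\<integral>\<^sup>+c. ennreal (c powr a) * indicator {0<..} c * (F r * indicator {r. c < M r} r) \<partial>lborel) \<partial>lborel)"
    by (rule lborel_pair.Fubini') measurable
  also have "\<dots> = (\<integral>\<^sup>+r. F r * ennreal (M r powr (a + 1) / (a + 1)) \<partial>lborel)"
  proof (rule nn_integral_cong)
    fix r
    have "(\<integral>\<^sup>+c. ennreal (c powr a) * indicator {0<..} c * (F r * indicator {r. c < M r} r) \<partial>lborel)
      = (\<integral>\<^sup>+c. F r * (ennreal (c powr a) * indicator {0<..<M r} c) \<partial>lborel)"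
      by (rule nn_integral_cong) (auto split: split_indicator simp: mult_ac)
    also have "\<dots> = F r * (\<integral>\<^sup>+c. ennreal (c powr a) * indicator {0<..<M r} c \<partial>lborel)"
      by (subst nn_integral_cmult) auto
    also have "(\<integral>\<^sup>+c. ennreal (c powr a) * indicator {0<..<M r} c \<partial>lborel) = (\<integral>\<^sup>+c. ennreal (c powr a) * indicator {0..M r} c \<partial>lborel)"
    proof (rule nn_integral_cong_AE)
      show "AE c in lborel. ennreal (c powr a) * indicator {0<..<M r} c = ennreal (c powr a) * indicator {0..M r} c"
        using AE_lborel_singleton[of 0] AE_lborel_singleton[of "M r"] by eventually_elim (auto split: split_indicator)
    qed
    also have "\<dots> = ennreal (M r powr (a + 1) / (a + 1))"
      by (rule nn_integral_has_integral_lebesgue') (use assms has_integral_powr_from_0 in auto)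
    finally show "(\<integral>\<^sup>+c. ennreal (c powr a) * indicator {0<..} c * (F r * indicator {r. c < M r} r) \<partial>lborel) = F r * ennreal (M r powr (a + 1) / (a + 1))" .
  qed
  finally show ?thesis .
qed

text \<open>Young's inequality for \<open>a / k\<close> and \<open>b powr (p - 1)\<close> with the
  exponents \<open>p\<close> and \<open>p / (p - 1)\<close>, multiplied by \<open>k\<close>. The
  free weight \<open>k\<close> is tuned in \<open>maximal_Hardy\<close> to give the sharp
  constant.\<close>

lemma Young_powr_scaled:
  fixes a b k p :: real
  assumes "1 < p" "0 < k" "0 \<le> a" "0 \<le> b"
  shows "a * b powr (p - 1) \<le> k powr (1 - p) / p * a powr p + k * (1 - 1 / p) * b powr p"
proof -
  have "a / k * b powr (p - 1) \<le> (a / k) powr p / p + (b powr (p - 1)) powr (p / (p - 1)) / (p / (p - 1))"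
    by (rule Youngs_inequality) (use assms in \<open>auto simp: field_simps\<close>)
  also have "(b powr (p - 1)) powr (p / (p - 1)) = b powr p" using assms by (simp add: powr_powr)
  also have "(a / k) powr p = k powr (-p) * a powr p"
    using assms by (simp add: powr_divide powr_minus_divide)
  finally have "k * (a / k * b powr (p - 1)) \<le> k * (k powr (-p) * a powr p / p + b powr p / (p / (p - 1)))"
    using assms by (intro mult_left_mono) auto
  moreover have "k powr (1 - p) = k * k powr (-p)" using assms by (simp add: powr_diff powr_minus_divide)
  ultimately show ?thesis using assms by (simp add: algebra_simps diff_divide_distrib)
qed

section \<open>One nonnegative profile on a ray, its primitive and its maximal function\<close>

locale hardy_profile =
  fixes g :: "real \<Rightarrow> real" and \<delta> R :: real
  assumes cont: "continuous_on UNIV g"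
    and nonneg: "\<And>t. 0 \<le> g t"
    and \<delta>_pos: "0 < \<delta>"
    and zero_near_0: "\<And>t. t \<le> \<delta> \<Longrightarrow> g t = 0"
    and zero_far: "\<And>t. R \<le> t \<Longrightarrow> g t = 0"
begin

definition G :: "real \<Rightarrow> real" where "G s = integral {0..s} g"

definition M :: "real \<Rightarrow> real" where "M r = (SUP s\<in>{r..}. G s / s)"

lemma g_integrable: "g integrable_on {a..b}"
  by (rule integrable_continuous_real) (rule continuous_on_subset[OF cont], simp)

lemma G_nonneg: "0 \<le> G s"
  unfolding G_def by (rule integral_nonneg) (auto simp: g_integrable nonneg)

lemma G_mono: "s \<le> t \<Longrightarrow> G s \<le> G t"
  unfolding G_def by (rule integral_subset_le) (auto simp: g_integrable nonneg)

lemma integral_g_eq_0: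
  assumes "\<And>t. t \<in> {a..b} \<Longrightarrow> g t = 0"
  shows "integral {a..b} g = 0"
proof -
  have "integral {a..b} g = integral {a..b} (\<lambda>_. 0)" by (rule integral_cong) (rule assms)
  then show ?thesis by simp
qed

lemma G_eq_0: "s \<le> \<delta> \<Longrightarrow> G s = 0"
  unfolding G_def by (rule integral_g_eq_0) (auto simp: zero_near_0)

lemma G_le_R: "G s \<le> G R"
proof -
  consider "s \<le> R" | "R \<le> 0" | "0 < R" "R < s" by linarith
  then show ?thesis
  proof cases
    case 1 then show ?thesis by (rule G_mono)
  next
    case 2
    have "G s = 0" unfolding G_def by (rule integral_g_eq_0) (use 2 zero_far in auto)
    then show ?thesis using G_nonneg by simp
  next
    case 3
    have "integral {0..R} g + integral {R..s} g = integral {0..s} g"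
      by (rule Henstock_Kurzweil_Integration.integral_combine) (use 3 g_integrable in auto)
    moreover have "integral {R..s} g = 0" by (rule integral_g_eq_0) (simp add: zero_far)
    ultimately show ?thesis by (simp add: G_def)
  qed
qed

text \<open>Below \<open>\<delta>\<close> the primitive is locally zero, which also covers negative
  arguments, where \<open>{0..s}\<close> is empty. From \<open>\<delta>\<close> on, \<open>t\<close>
  is interior to \<open>{0..t + 1}\<close>, so the one-sided fundamental theorem yields a full
  derivative.\<close>

lemma G_deriv: "(G has_real_derivative g t) (at t)"
proof (cases "t < \<delta>")
  case True
  have "((\<lambda>_. 0) has_real_derivative g t) (at t)" using True zero_near_0 by simp
  then show ?thesis
    by (rule has_field_derivative_transform_within_open[of _ _ _ "{..<\<delta>}"]) (use True G_eq_0 in auto)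
next
  case False
  have "((\<lambda>x. integral {0..x} g) has_real_derivative g t) (at t within {0..t + 1})"
    by (rule integral_has_real_derivative) (use False \<delta>_pos in \<open>auto intro: continuous_on_subset[OF cont]\<close>)
  then show ?thesis using False \<delta>_pos at_within_Icc_at[of 0 t "t + 1"] by (simp add: G_def[abs_def])
qed

lemma G_isCont: "isCont G t"
  using G_deriv DERIV_isCont by blast

text \<open>\<open>G\<close> vanishes up to \<open>\<delta>\<close> and never exceeds
  \<open>G R\<close>. The \<open>max\<close> records both consequences: boundedness of the ratio
  near 0 and decay like \<open>1 / s\<close> at infinity.\<close>

lemma ratio_le:
  assumes "0 < s"
  shows "G s / s \<le> G R / max s \<delta>"
  using G_eq_0[of s] G_le_R[of s] G_nonneg[of R] assms \<delta>_pos
  by (auto simp: max_def intro!: divide_right_mono)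

lemma ratio_bdd: "0 < r \<Longrightarrow> bdd_above ((\<lambda>s. G s / s) ` {r..})"
proof (rule bdd_aboveI2)
  fix s assume "0 < r" "s \<in> {r..}"
  then show "G s / s \<le> G R / \<delta>"
    using ratio_le[of s] G_nonneg[of R] \<delta>_pos
    by (smt (verit) atLeast_iff frac_le max_def)
qed

lemma ratio_le_M: "0 < r \<Longrightarrow> r \<le> s \<Longrightarrow> G s / s \<le> M r"
  unfolding M_def by (rule cSUP_upper) (auto simp: ratio_bdd)

lemma M_nonneg: "0 < r \<Longrightarrow> 0 \<le> M r"
  using ratio_le_M[of r r] G_nonneg[of r] by (smt (verit) divide_nonneg_pos)

lemma M_le: "0 < r \<Longrightarrow> M r \<le> G R / max r \<delta>"
  unfolding M_def
proof (rule cSUP_least)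
  fix s assume "0 < r" "s \<in> {r..}"
  then show "G s / s \<le> G R / max r \<delta>"
    using ratio_le[of s] G_nonneg[of R] \<delta>_pos
      divide_left_mono[of "max r \<delta>" "max s \<delta>" "G R"] by (auto simp: max_def split: if_splits)
qed auto

lemma less_M_iff: "0 < r \<Longrightarrow> c < M r \<longleftrightarrow> (\<exists>s\<ge>r. c < G s / s)"
  unfolding M_def by (subst less_cSUP_iff) (auto simp: ratio_bdd)

lemma M_antimono: "0 < r \<Longrightarrow> r \<le> s \<Longrightarrow> M s \<le> M r"
  unfolding M_def by (rule cSUP_subset_mono) (auto simp: ratio_bdd)

text \<open>\<open>M\<close> exceeds \<open>c\<close> at \<open>r\<close> exactly when the set
  \<open>T\<close> below has a point at or beyond \<open>r\<close>. \<open>T\<close> is bounded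
  because \<open>G\<close> is, and open by continuity of the ratio, so its supremum
  \<open>\<rho>\<close> is finite and not attained; this gives an open interval. Approaching
  \<open>\<rho>\<close> from within \<open>T\<close> gives the inequality at
  \<open>\<rho>\<close>.\<close>

lemma superlevel_M:
  assumes "0 < c"
  obtains "{r. 0 < r \<and> c < M r} = {}"
  | \<rho> where "0 < \<rho>" "{r. 0 < r \<and> c < M r} = {0<..<\<rho>}" "c * \<rho> \<le> G \<rho>"
proof (cases "{r. 0 < r \<and> c < M r} = {}")
  case False
  define T where "T = {s. 0 < s \<and> c < G s / s}"
  have ne: "T \<noteq> {}" using False less_M_iff unfolding T_def by force
  have bd: "s \<le> G R / c" if "s \<in> T" for s
    using that assms G_le_R[of s] unfolding T_def by (auto simp: field_simps)
  then have bdd: "bdd_above T" by (rule bdd_aboveI)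
  define \<rho> where "\<rho> = Sup T"
  have up: "s \<le> \<rho>" if "s \<in> T" for s unfolding \<rho>_def by (rule cSup_upper[OF that bdd])
  have pos: "0 < \<rho>" using ne up unfolding T_def by force
  have below: "\<exists>s\<in>T. r < s" if "r < \<rho>" for r
    using that unfolding \<rho>_def by (subst (asm) less_cSup_iff[OF ne bdd])
  have cont_ratio: "isCont (\<lambda>s. G s / s) \<rho>" by (intro continuous_intros G_isCont) (use pos in auto)
  have lim: "((\<lambda>s. G s / s) \<longlongrightarrow> G \<rho> / \<rho>) (nhds \<rho>)"
    using cont_ratio tendsto_at_iff_tendsto_nhds[of "\<lambda>s. G s / s" \<rho>] by (simp add: isCont_def)
  have ge: "c \<le> G \<rho> / \<rho>"
  proof (rule ccontr)
    assume "\<not> ?thesis"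
    then have "G \<rho> / \<rho> < c" by simp
    then have "\<forall>\<^sub>F x in nhds \<rho>. G x / x < c" by (rule order_tendstoD(2)[OF lim])
    then obtain e where e: "e > 0" "\<And>x. dist x \<rho> < e \<Longrightarrow> G x / x < c"
      by (auto simp: eventually_nhds_metric)
    obtain s where "s \<in> T" "\<rho> - e < s" using below[of "\<rho> - e"] e by auto
    then show False using up[of s] e(2)[of s] unfolding T_def by (auto simp: dist_real_def)
  qed
  have notin: "\<rho> \<notin> T"
  proof
    assume "\<rho> \<in> T"
    then have "\<forall>\<^sub>F x in nhds \<rho>. c < G x / x"
      by (intro order_tendstoD(1)[OF lim]) (simp add: T_def)
    then obtain e where e: "e > 0" "\<And>x. dist x \<rho> < e \<Longrightarrow> c < G x / x"
      by (auto simp: eventually_nhds_metric)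
    have "\<rho> + e/2 \<in> T" using e pos unfolding T_def by (auto simp: dist_real_def)
    then show False using up[of "\<rho> + e/2"] e by auto
  qed
  have "{r. 0 < r \<and> c < M r} = {0<..<\<rho>}"
  proof (intro set_eqI iffI)
    fix r assume "r \<in> {r. 0 < r \<and> c < M r}"
    then obtain s where "0 < r" "r \<le> s" "c < G s / s" using less_M_iff by auto
    then have "s \<in> T" by (auto simp: T_def)
    then show "r \<in> {0<..<\<rho>}" using \<open>0 < r\<close> \<open>r \<le> s\<close> up[of s] notin by (cases "s = \<rho>") auto
  next
    fix r assume "r \<in> {0<..<\<rho>}"
    then show "r \<in> {r. 0 < r \<and> c < M r}" using below[of r] less_M_iff[of r c] by (auto simp: T_def intro: less_imp_le)
  qed
  then show ?thesis using that(2)[OF pos] ge pos by (auto simp: field_simps)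
qed (use that in auto)

text \<open>On \<open>E = (0, \<rho>)\<close> the left integral is
  \<open>c * \<rho> ^ (m + 1)\<close>, at most \<open>\<rho> ^ m * G \<rho>\<close>. The latter is
  the integral of the derivative of \<open>r ^ m * G r\<close>, in which \<open>G r / r\<close> is
  bounded by \<open>M r\<close>. In the application \<open>m\<close> is the dimension minus
  one.\<close>

lemma superlevel_estimate:
  fixes m :: nat
  assumes c: "0 < c"
  defines "E \<equiv> {r. 0 < r \<and> c < M r}"
  shows "(\<integral>\<^sup>+r. ennreal (c * real (Suc m) * r ^ m) * indicator E r \<partial>lborel)
     \<le> (\<integral>\<^sup>+r. ennreal (r ^ m * g r + real m * r ^ m * M r) * indicator E r \<partial>lborel)"
proof (cases rule: superlevel_M[OF c])
  case 1
  then show ?thesis by (simp add: E_def)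
next
  case (2 \<rho>)
  have E: "E = {0<..<\<rho>}" using 2 E_def by simp
  have lhs: "(\<integral>\<^sup>+r. ennreal (c * real (Suc m) * r ^ m) * indicator {0..\<rho>} r \<partial>lborel) = c * \<rho> ^ Suc m - c * 0 ^ Suc m"
  proof (rule nn_integral_FTC_Icc[where F="\<lambda>r. c * r ^ Suc m"])
    show "((\<lambda>r. c * r ^ Suc m) has_real_derivative c * real (Suc m) * x ^ m) (at x)" for x
      by (rule DERIV_cong[OF DERIV_cmult[OF DERIV_pow]]) simp
  qed (use 2 c in auto)
  have rhs: "(\<integral>\<^sup>+r. ennreal (real m * r ^ (m - 1) * G r + r ^ m * g r) * indicator {0..\<rho>} r \<partial>lborel) = \<rho> ^ m * G \<rho> - 0 ^ m * G 0"
  proof (rule nn_integral_FTC_Icc[where F="\<lambda>r. r ^ m * G r"])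
    have "continuous_on UNIV G" using G_isCont by (simp add: continuous_at_imp_continuous_on)
    then show "(\<lambda>r. real m * r ^ (m - 1) * G r + r ^ m * g r) \<in> borel_measurable borel"
      by (intro borel_measurable_continuous_onI continuous_intros cont)
    show "((\<lambda>r. r ^ m * G r) has_real_derivative real m * x ^ (m - 1) * G x + x ^ m * g x) (at x)" for x
      by (rule DERIV_cong[OF DERIV_mult[OF DERIV_pow G_deriv]]) simp
  qed (use 2 G_nonneg nonneg in auto)
  have "(\<integral>\<^sup>+r. ennreal (c * real (Suc m) * r ^ m) * indicator E r \<partial>lborel)
    \<le> (\<integral>\<^sup>+r. ennreal (c * real (Suc m) * r ^ m) * indicator {0..\<rho>} r \<partial>lborel)"
    by (rule nn_integral_mono) (auto simp: E split: split_indicator)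
  also have "\<dots> = ennreal (c * \<rho> ^ Suc m)" by (subst lhs) simp
  \<comment> \<open>The boundary term at 0 vanishes through \<open>G 0 = 0\<close>, also for
    \<open>m = 0\<close>, where \<open>0 ^ m\<close> is 1.\<close>
  also have "\<dots> \<le> ennreal (\<rho> ^ m * G \<rho> - 0 ^ m * G 0)"
    using 2 G_eq_0[of 0] \<delta>_pos by (intro ennreal_leI) (auto simp: mult_ac intro!: mult_left_mono)
  also have "\<dots> = (\<integral>\<^sup>+r. ennreal (real m * r ^ (m - 1) * G r + r ^ m * g r) * indicator {0..\<rho>} r \<partial>lborel)"
    by (rule rhs[symmetric])
  also have "\<dots> \<le> (\<integral>\<^sup>+r. ennreal (r ^ m * g r + real m * r ^ m * M r) * indicator E r \<partial>lborel)"
  proof (rule nn_integral_mono_AE)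
    have "AE r in lborel. r \<noteq> 0 \<and> r \<noteq> \<rho>" using AE_lborel_singleton[of 0] AE_lborel_singleton[of \<rho>] by eventually_elim auto
    then show "AE r in lborel. ennreal (real m * r ^ (m - 1) * G r + r ^ m * g r) * indicator {0..\<rho>} r
      \<le> ennreal (r ^ m * g r + real m * r ^ m * M r) * indicator E r"
    proof eventually_elim
      case (elim r)
      show ?case
      proof (cases "r \<in> E")
        case True
        then have r: "0 < r" "r < \<rho>" by (auto simp: E)
        \<comment> \<open>For \<open>m = 0\<close> the exponent \<open>m - 1\<close> is truncated,
          but the factor \<open>real m\<close> annihilates both sides.\<close>
        have "real m * r ^ (m - 1) * G r = real m * (r ^ m * (G r / r))"
          using r by (cases m) auto
        also have "\<dots> \<le> real m * (r ^ m * M r)"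
          using r ratio_le_M[of r r] by (intro mult_left_mono) auto
        finally show ?thesis using r True by (auto intro!: ennreal_leI)
      qed (use elim in \<open>auto simp: E split: split_indicator\<close>)
    qed
  qed
  finally show ?thesis .
qed

text \<open>Setting the value to 0 off the positive half-line gives a nonnegative Borel function on
  the whole line, as \<open>layer_cake_powr\<close> requires.\<close>

definition M0 :: "real \<Rightarrow> real" where "M0 r = (if 0 < r then M r else 0)"

lemma M0_nonneg: "0 \<le> M0 r"
  by (simp add: M0_def M_nonneg)

lemma M0_measurable [measurable]: "M0 \<in> borel_measurable borel"
proof -
  have "mono_on {0<..} (\<lambda>r. - M r)" by (auto intro!: mono_onI M_antimono)
  then have "(\<lambda>r. - M r) \<in> borel_measurable (restrict_space borel {0<..})"
    by (rule borel_measurable_mono_on_fnc)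
  then have "(\<lambda>r. - (- M r)) \<in> borel_measurable (restrict_space borel {0<..})" by measurable
  then have "(\<lambda>r. if r \<in> {0<..} then M r else 0) \<in> borel_measurable borel"
    by (subst measurable_If_restrict_space_iff) (auto simp: greaterThan_def)
  then show ?thesis by (simp add: M0_def[abs_def])
qed

text \<open>Finiteness is what allows a multiple of this integral to be absorbed in
  \<open>maximal_Hardy\<close>. Up to \<open>\<delta>\<close> the maximal function is at most
  \<open>K / \<delta>\<close>, beyond it at most \<open>K / r\<close>, and
  \<open>r powr (m - p)\<close> is integrable at infinity because \<open>m - p < -1\<close>.\<close>

lemma weighted_M_finite:
  fixes m :: nat
  assumes p: "real (Suc m) < p"
  shows "(\<integral>\<^sup>+r. ennreal (r ^ m * M0 r powr p) * indicator {0<..} r \<partial>lborel) < \<infinity>"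
proof -
  define K where "K = G R"
  have K: "0 \<le> K" by (simp add: K_def G_nonneg)
  have tail: "(\<integral>\<^sup>+r. ennreal (r powr (real m - p)) * indicator {\<delta>..} r \<partial>lborel) < \<infinity>"
    by (subst nn_integral_has_integral_lebesgue'[OF _ has_integral_powr_to_inf]) (use p \<delta>_pos in auto)
  have "(\<integral>\<^sup>+r. ennreal (r ^ m * M0 r powr p) * indicator {0<..} r \<partial>lborel)
     \<le> (\<integral>\<^sup>+r. ennreal (\<delta> ^ m * (K / \<delta>) powr p) * indicator {0..\<delta>} r
            + ennreal (K powr p) * (ennreal (r powr (real m - p)) * indicator {\<delta>..} r) \<partial>lborel)"
  proof (rule nn_integral_mono)
    fix r
    show "ennreal (r ^ m * M0 r powr p) * indicator {0<..} r \<le> ennreal (\<delta> ^ m * (K / \<delta>) powr p) * indicator {0..\<delta>} r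
            + ennreal (K powr p) * (ennreal (r powr (real m - p)) * indicator {\<delta>..} r)"
    proof (cases "0 < r")
      case r: True
      show ?thesis
      proof (cases "r < \<delta>")
        case True
        have "M0 r \<le> K / \<delta>" using M_le[OF r] True r by (simp add: M0_def K_def)
        then have "r ^ m * M0 r powr p \<le> \<delta> ^ m * (K / \<delta>) powr p"
          using r True p M0_nonneg by (intro mult_mono power_mono powr_mono2) auto
        then show ?thesis using r True by (auto intro: ennreal_leI)
      next
        case False
        have "M0 r \<le> K / r" using M_le[OF r] False r by (simp add: M0_def K_def max_def split: if_splits)
        then have "r ^ m * M0 r powr p \<le> r ^ m * (K / r) powr p"
          using r p M0_nonneg by (intro mult_mono power_mono powr_mono2) auto
        also have "\<dots> = K powr p * r powr (real m - p)"
          using r K by (simp add: powr_divide powr_diff powr_realpow)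
        finally have "ennreal (r ^ m * M0 r powr p) \<le> ennreal (K powr p) * ennreal (r powr (real m - p))"
          by (simp add: ennreal_leI flip: ennreal_mult)
        then show ?thesis using r False by (auto intro: add_increasing)
      qed
    qed auto
  qed
  also have "\<dots> = ennreal (\<delta> ^ m * (K / \<delta>) powr p) * emeasure lborel {0..\<delta>}
     + ennreal (K powr p) * (\<integral>\<^sup>+r. ennreal (r powr (real m - p)) * indicator {\<delta>..} r \<partial>lborel)"
    by (subst nn_integral_add) (auto simp: nn_integral_cmult)
  also have "\<dots> < \<infinity>" using tail \<delta>_pos by (auto simp: ennreal_mult_less_top)
  finally show ?thesis .
qed

text \<open>\<open>superlevel_estimate\<close> is integrated in \<open>c\<close> against
  \<open>c powr (p - 2)\<close>. The layer cake formula evaluates the left side with exponent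
  \<open>p - 1\<close> and the right side with exponent \<open>p - 2\<close>, which produces the
  factors \<open>1 / p\<close> and \<open>1 / (p - 1)\<close>.\<close>

lemma weighted_M_le_mixed:
  fixes m :: nat
  assumes p: "1 < p"
  shows "(\<integral>\<^sup>+r. ennreal (real (Suc m) / p * (r ^ m * M0 r powr p)) * indicator {0<..} r \<partial>lborel)
     \<le> (\<integral>\<^sup>+r. ennreal ((r ^ m * g r * M0 r powr (p - 1) + real m * (r ^ m * M0 r powr p)) / (p - 1)) * indicator {0<..} r \<partial>lborel)"
proof -
  have [measurable]: "g \<in> borel_measurable borel" by (rule borel_measurable_continuous_onI[OF cont])
  \<comment> \<open>This includes \<open>x = 0\<close>, where \<open>powr\<close> has the value
    0.\<close>
  have M0_powr: "x * x powr (q - 1) = x powr q" if "0 \<le> x" for x q :: real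
    using that by (cases "x = 0") (auto simp: powr_diff)
  have "(\<integral>\<^sup>+r. ennreal (real (Suc m) / p * (r ^ m * M0 r powr p)) * indicator {0<..} r \<partial>lborel)
     = (\<integral>\<^sup>+r. ennreal (real (Suc m) * r ^ m) * indicator {0<..} r * ennreal (M0 r powr ((p - 1) + 1) / ((p - 1) + 1)) \<partial>lborel)"
  proof (rule nn_integral_cong)
    fix r
    show "ennreal (real (Suc m) / p * (r ^ m * M0 r powr p)) * indicator {0<..} r
      = ennreal (real (Suc m) * r ^ m) * indicator {0<..} r * ennreal (M0 r powr ((p - 1) + 1) / ((p - 1) + 1))"
    proof (cases "0 < r")
      case True
      have "real (Suc m) / p * (r ^ m * M0 r powr p) = (real (Suc m) * r ^ m) * (M0 r powr p / p)" by simp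
      also have "ennreal \<dots> = ennreal (real (Suc m) * r ^ m) * ennreal (M0 r powr p / p)"
        by (rule ennreal_mult) (use True p in auto)
      finally show ?thesis using True by (simp del: of_nat_Suc)
    qed simp
  qed
  also have "\<dots> = (\<integral>\<^sup>+c. ennreal (c powr (p - 1)) * indicator {0<..} c
      * (\<integral>\<^sup>+r. ennreal (real (Suc m) * r ^ m) * indicator {0<..} r * indicator {r. c < M0 r} r \<partial>lborel) \<partial>lborel)"
    by (rule layer_cake_powr[symmetric]) (use p M0_nonneg in auto)
  also have "\<dots> \<le> (\<integral>\<^sup>+c. ennreal (c powr (p - 2)) * indicator {0<..} c
      * (\<integral>\<^sup>+r. ennreal (r ^ m * g r + real m * r ^ m * M0 r) * indicator {0<..} r * indicator {r. c < M0 r} r \<partial>lborel) \<partial>lborel)"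
  proof (rule nn_integral_mono)
    fix c :: real
    show "ennreal (c powr (p - 1)) * indicator {0<..} c
        * (\<integral>\<^sup>+r. ennreal (real (Suc m) * r ^ m) * indicator {0<..} r * indicator {r. c < M0 r} r \<partial>lborel)
      \<le> ennreal (c powr (p - 2)) * indicator {0<..} c
        * (\<integral>\<^sup>+r. ennreal (r ^ m * g r + real m * r ^ m * M0 r) * indicator {0<..} r * indicator {r. c < M0 r} r \<partial>lborel)"
    proof (cases "0 < c")
      case c: True
      \<comment> \<open>One factor \<open>c\<close> is split off and moved under the inner integral,
        where \<open>superlevel_estimate\<close> consumes it; hence the weight drops from
        \<open>p - 1\<close> to \<open>p - 2\<close>.\<close>
      have split: "c powr (p - 1) = c powr (p - 2) * c" using M0_powr[of c "p - 1"] c by (simp add: mult.commute)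
      have "ennreal c * (\<integral>\<^sup>+r. ennreal (real (Suc m) * r ^ m) * indicator {0<..} r * indicator {r. c < M0 r} r \<partial>lborel)
         = (\<integral>\<^sup>+r. ennreal c * (ennreal (real (Suc m) * r ^ m) * indicator {0<..} r * indicator {r. c < M0 r} r) \<partial>lborel)"
        by (rule nn_integral_cmult[symmetric]) measurable
      also have "\<dots> = (\<integral>\<^sup>+r. ennreal (c * real (Suc m) * r ^ m) * indicator {r. 0 < r \<and> c < M r} r \<partial>lborel)"
      proof (rule nn_integral_cong)
        fix r
        show "ennreal c * (ennreal (real (Suc m) * r ^ m) * indicator {0<..} r * indicator {r. c < M0 r} r)
          = ennreal (c * real (Suc m) * r ^ m) * indicator {r. 0 < r \<and> c < M r} r"
        proof (cases "0 < r")
          case True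
          have "ennreal (c * real (Suc m) * r ^ m) = ennreal c * ennreal (real (Suc m) * r ^ m)"
            unfolding mult.assoc by (rule ennreal_mult) (use c True in auto)
          moreover have "M0 r = M r" using True by (simp add: M0_def)
          ultimately show ?thesis using True by (simp add: indicator_def)
        qed simp
      qed
      also have "\<dots> \<le> (\<integral>\<^sup>+r. ennreal (r ^ m * g r + real m * r ^ m * M r) * indicator {r. 0 < r \<and> c < M r} r \<partial>lborel)"
        by (rule superlevel_estimate[OF c])
      also have "\<dots> = (\<integral>\<^sup>+r. ennreal (r ^ m * g r + real m * r ^ m * M0 r) * indicator {0<..} r * indicator {r. c < M0 r} r \<partial>lborel)"
      proof (rule nn_integral_cong)
        fix r
        show "ennreal (r ^ m * g r + real m * r ^ m * M r) * indicator {r. 0 < r \<and> c < M r} r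
          = ennreal (r ^ m * g r + real m * r ^ m * M0 r) * indicator {0<..} r * indicator {r. c < M0 r} r"
        proof (cases "0 < r")
          case True
          then have "M0 r = M r" by (simp add: M0_def)
          then show ?thesis using True by (simp add: indicator_def)
        qed simp
      qed
      finally have "ennreal (c powr (p - 2)) * (ennreal c * (\<integral>\<^sup>+r. ennreal (real (Suc m) * r ^ m) * indicator {0<..} r * indicator {r. c < M0 r} r \<partial>lborel))
        \<le> ennreal (c powr (p - 2)) * (\<integral>\<^sup>+r. ennreal (r ^ m * g r + real m * r ^ m * M0 r) * indicator {0<..} r * indicator {r. c < M0 r} r \<partial>lborel)"
        by (rule mult_left_mono) simp
      moreover have "ennreal (c powr (p - 1)) = ennreal (c powr (p - 2)) * ennreal c"
        unfolding split by (rule ennreal_mult) (use c in auto)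
      ultimately show ?thesis using c by (simp add: mult.assoc)
    qed simp
  qed
  also have "\<dots> = (\<integral>\<^sup>+r. ennreal (r ^ m * g r + real m * r ^ m * M0 r) * indicator {0<..} r * ennreal (M0 r powr ((p - 2) + 1) / ((p - 2) + 1)) \<partial>lborel)"
    by (rule layer_cake_powr) (use p M0_nonneg in auto)
  also have "\<dots> = (\<integral>\<^sup>+r. ennreal ((r ^ m * g r * M0 r powr (p - 1) + real m * (r ^ m * M0 r powr p)) / (p - 1)) * indicator {0<..} r \<partial>lborel)"
  proof (rule nn_integral_cong)
    fix r
    show "ennreal (r ^ m * g r + real m * r ^ m * M0 r) * indicator {0<..} r * ennreal (M0 r powr ((p - 2) + 1) / ((p - 2) + 1))
      = ennreal ((r ^ m * g r * M0 r powr (p - 1) + real m * (r ^ m * M0 r powr p)) / (p - 1)) * indicator {0<..} r"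
    proof (cases "0 < r")
      case True
      have "(r ^ m * g r + real m * r ^ m * M0 r) * (M0 r powr (p - 1) / (p - 1))
        = (r ^ m * g r * M0 r powr (p - 1) + real m * (r ^ m * (M0 r * M0 r powr (p - 1)))) / (p - 1)"
        by (simp add: algebra_simps add_divide_distrib)
      also have "M0 r * M0 r powr (p - 1) = M0 r powr p" by (rule M0_powr) (rule M0_nonneg)
      finally have "ennreal (r ^ m * g r + real m * r ^ m * M0 r) * ennreal (M0 r powr (p - 1) / (p - 1))
        = ennreal ((r ^ m * g r * M0 r powr (p - 1) + real m * (r ^ m * M0 r powr p)) / (p - 1))"
        using True p nonneg[of r] M0_nonneg[of r] by (subst ennreal_mult[symmetric]) auto
      then show ?thesis using True by simp
    qed simp
  qed
  finally show ?thesis .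
qed

text \<open>Young's inequality gives \<open>(m + 1) / p * J <= c * A + b * J\<close>. Since
  \<open>J\<close> is finite, the last term can be absorbed. The coefficient left over is
  \<open>k / (p * (p - 1))\<close>, which equals \<open>c * k powr p\<close>, so the constant is
  \<open>k powr (- p)\<close>.\<close>

lemma maximal_Hardy:
  fixes m :: nat
  assumes p: "real (Suc m) < p"
  shows "(\<integral>\<^sup>+r. ennreal (r ^ m * M0 r powr p) * indicator {0<..} r \<partial>lborel)
    \<le> ennreal ((p / (p - real (Suc m))) powr p) * (\<integral>\<^sup>+r. ennreal (r ^ m * g r powr p) * indicator {0<..} r \<partial>lborel)"
proof -
  have [measurable]: "g \<in> borel_measurable borel" by (rule borel_measurable_continuous_onI[OF cont])
  \<comment> \<open>With a general weight \<open>k\<close> and \<open>N = m + 1\<close>, absorption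
    would give the constant \<open>k powr (1 - p) / (p - N - (p - 1) * k)\<close>; the value chosen
    here minimises it.\<close>
  define k where "k = (p - real (Suc m)) / p"
  define c where "c = k powr (1 - p) / (p * (p - 1))"
  define b where "b = k / p + real m / (p - 1)"
  have p1: "1 < p" using p by linarith
  have k: "0 < k" using p p1 by (simp add: k_def)
  have c: "0 < c" and b: "0 \<le> b" using k p1 by (auto simp: c_def b_def)
  define J where "J = (\<integral>\<^sup>+r. ennreal (r ^ m * M0 r powr p) * indicator {0<..} r \<partial>lborel)"
  define A where "A = (\<integral>\<^sup>+r. ennreal (r ^ m * g r powr p) * indicator {0<..} r \<partial>lborel)"
  have "ennreal (real (Suc m) / p) * J = (\<integral>\<^sup>+r. ennreal (real (Suc m) / p) * (ennreal (r ^ m * M0 r powr p) * indicator {0<..} r) \<partial>lborel)"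
    unfolding J_def by (rule nn_integral_cmult[symmetric]) measurable
  also have "\<dots> = (\<integral>\<^sup>+r. ennreal (real (Suc m) / p * (r ^ m * M0 r powr p)) * indicator {0<..} r \<partial>lborel)"
    using p1 by (intro nn_integral_cong) (auto split: split_indicator simp: simp flip: ennreal_mult)
  also have "\<dots> \<le> (\<integral>\<^sup>+r. ennreal ((r ^ m * g r * M0 r powr (p - 1) + real m * (r ^ m * M0 r powr p)) / (p - 1)) * indicator {0<..} r \<partial>lborel)"
    by (rule weighted_M_le_mixed[OF p1])
  also have "\<dots> \<le> (\<integral>\<^sup>+r. ennreal c * (ennreal (r ^ m * g r powr p) * indicator {0<..} r)
       + ennreal b * (ennreal (r ^ m * M0 r powr p) * indicator {0<..} r) \<partial>lborel)"
  proof (rule nn_integral_mono)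
    fix r
    show "ennreal ((r ^ m * g r * M0 r powr (p - 1) + real m * (r ^ m * M0 r powr p)) / (p - 1)) * indicator {0<..} r
      \<le> ennreal c * (ennreal (r ^ m * g r powr p) * indicator {0<..} r)
       + ennreal b * (ennreal (r ^ m * M0 r powr p) * indicator {0<..} r)"
    proof (cases "0 < r")
      case r: True
      have "r ^ m * g r * M0 r powr (p - 1) \<le> r ^ m * (k powr (1 - p) / p * g r powr p + k * (1 - 1 / p) * M0 r powr p)"
        unfolding mult.assoc by (intro mult_left_mono Young_powr_scaled[unfolded mult.assoc]) (use r p1 k nonneg M0_nonneg in auto)
      then have "(r ^ m * g r * M0 r powr (p - 1) + real m * (r ^ m * M0 r powr p)) / (p - 1)
        \<le> (r ^ m * (k powr (1 - p) / p * g r powr p + k * (1 - 1 / p) * M0 r powr p) + real m * (r ^ m * M0 r powr p)) / (p - 1)"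
        using p1 by (intro divide_right_mono add_right_mono) auto
      also have "\<dots> = c * (r ^ m * g r powr p) + b * (r ^ m * M0 r powr p)"
      proof -
        \<comment> \<open>The powers are abstracted to variables, and below \<open>p - 1\<close> to
          \<open>q\<close>, so that clearing denominators is a purely rational computation.\<close>
        have "(w * (u / p * x + k * (1 - 1 / p) * y) + v * (w * y)) / (p - 1)
          = u / (p * (p - 1)) * (w * x) + (k / p + v / (p - 1)) * (w * y)" for w u v x y :: real
        proof -
          have "k * (1 - 1 / p) = (p - 1) * (k / p)" using p1 by (simp add: field_simps)
          moreover have "(w * (u / p * x + q * (k / p) * y) + v * (w * y)) / q
            = u / (p * q) * (w * x) + (k / p + v / q) * (w * y)" if "q \<noteq> 0" for q
            using that p1 by (simp add: field_simps)
          ultimately show ?thesis using p1 by simp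
        qed
        then show ?thesis unfolding b_def c_def .
      qed
      finally show ?thesis using r c b by (simp add: ennreal_leI flip: ennreal_mult ennreal_plus)
    qed simp
  qed
  also have "\<dots> = ennreal c * A + ennreal b * J"
    unfolding J_def A_def by (subst nn_integral_add) (auto simp: nn_integral_cmult)
  finally have main: "ennreal (real (Suc m) / p) * J \<le> ennreal c * A + ennreal b * J" .
  have coeff: "real (Suc m) / p - b = k / (p * (p - 1))"
  proof -
    have N: "real (Suc m) = p - k * p" "real m = p - k * p - 1" using p1 by (simp_all add: k_def)
    have "k * p - k * (p - 1) = k" by (simp add: right_diff_distrib)
    then have "k / (p - 1) - k / p = k / (p * (p - 1))"
      using p1 by (simp add: diff_frac_eq mult.commute)
    moreover have "(p - k * p) / p = 1 - k" using p1 by (simp add: diff_divide_distrib)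
    moreover have "p - k * p - 1 = (1 - k) * (p - 1) - k" by (simp add: left_diff_distrib right_diff_distrib)
    then have "(p - k * p - 1) / (p - 1) = 1 - k - k / (p - 1)" using p1 by (simp add: diff_divide_distrib)
    ultimately show ?thesis unfolding b_def N by simp
  qed
  have kp: "(p / (p - real (Suc m))) powr p = k powr (- p)"
    using p p1 by (simp add: k_def powr_minus powr_divide)
  have ck: "c = k powr (- p) * (k / (p * (p - 1)))"
    using k by (simp add: c_def powr_diff powr_minus field_simps)
  have "J \<le> ennreal (k powr (- p)) * A"
  proof (cases "A = \<infinity>")
    case True then show ?thesis using k by (simp add: ennreal_mult_top)
  next
    case False
    obtain j where j: "J = ennreal j" "0 \<le> j"
      using weighted_M_finite[OF p] unfolding J_def[symmetric] by (cases J) auto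
    obtain a where a: "A = ennreal a" "0 \<le> a" using False by (cases A) auto
    have "real (Suc m) / p * j \<le> c * a + b * j"
      using main j a p1 c b by (simp flip: ennreal_mult ennreal_plus)
    then have "(real (Suc m) / p - b) * j \<le> c * a" by (simp add: algebra_simps)
    then have "(k / (p * (p - 1))) * j \<le> (k / (p * (p - 1))) * (k powr (- p) * a)"
      unfolding coeff ck by (simp add: mult_ac)
    then have "j \<le> k powr (- p) * a" using k p1 by (subst (asm) mult_le_cancel_left_pos) auto
    then show ?thesis using j a by (simp add: ennreal_leI flip: ennreal_mult)
  qed
  then show ?thesis unfolding kp J_def A_def .
qed

end

subsection \<open>Polar coordinates\<close>

text \<open>In polar coordinates this is the rectangle \<open>(0, a)\<close> times \<open>B\<close>;
  radius 1 is the cone that defines \<open>sphere_measure\<close>.\<close>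

definition truncated_cone :: "'a::euclidean_space set \<Rightarrow> real \<Rightarrow> 'a set"
  where "truncated_cone B a = {x. 0 < norm x \<and> norm x < a \<and> sgn x \<in> B}"

definition radial_measure :: "nat \<Rightarrow> real measure"
  where "radial_measure n = density lborel (\<lambda>r. ennreal (r ^ n) * indicator {0<..} r)"

lemma space_sphere_measure [simp]: "space (sphere_measure :: 'a::euclidean_space measure) = sphere 0 1"
  by (simp add: sphere_measure_def space_scale_measure space_restrict_space)

lemma sets_sphere_measure [measurable_cong]:
  "sets (sphere_measure :: 'a::euclidean_space measure) = sets (restrict_space borel (sphere 0 1))"
  by (simp add: sphere_measure_def)

lemma sgn_borel_measurable [measurable]: "(sgn :: 'a::euclidean_space \<Rightarrow> 'a) \<in> borel_measurable borel"
  unfolding sgn_div_norm[abs_def] by measurable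

lemma truncated_cone_sets:
  assumes "B \<in> sets (sphere_measure :: 'a::euclidean_space measure)"
  shows "truncated_cone B a \<in> sets borel"
proof -
  have [measurable]: "B \<in> sets borel" using assms by (auto simp: sets_sphere_measure sets_restrict_space_iff)
  have "truncated_cone B a = {x \<in> space borel. 0 < norm x \<and> norm x < a \<and> sgn x \<in> B}" by (simp add: truncated_cone_def)
  also have "\<dots> \<in> sets borel" by measurable
  finally show ?thesis .
qed

lemma emeasure_sphere_truncated_cone:
  assumes "B \<in> sets (sphere_measure :: 'a::euclidean_space measure)"
  shows "emeasure sphere_measure B = of_nat DIM('a) * emeasure lborel (truncated_cone B 1)"
proof -
  have "B \<in> sets borel" "B \<subseteq> sphere 0 1" using assms by (auto simp: sets_sphere_measure sets_restrict_space_iff)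
  from emeasure_sphere_measure[OF this] show ?thesis by (simp add: truncated_cone_def sgn_div_norm)
qed

lemma emeasure_truncated_cone_scale:
  assumes B: "B \<in> sets (sphere_measure :: 'a::euclidean_space measure)" and a: "0 < a"
  shows "emeasure lborel (truncated_cone B a) = ennreal (a ^ DIM('a)) * emeasure lborel (truncated_cone B 1)"
proof -
  have [measurable]: "truncated_cone B a \<in> sets borel" "truncated_cone B 1 \<in> sets borel" using B by (rule truncated_cone_sets)+
  have vim: "a *\<^sub>R x \<in> truncated_cone B a \<longleftrightarrow> x \<in> truncated_cone B 1" for x
    using a by (simp add: truncated_cone_def sgn_scaleR)
  have "emeasure lborel (truncated_cone B a)
    = emeasure (density (distr lborel borel (\<lambda>x. 0 + a *\<^sub>R x)) (\<lambda>_. ennreal (\<bar>a\<bar> ^ DIM('a)))) (truncated_cone B a)"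
    using a by (subst lborel_affine[of a 0]) auto
  also have "\<dots> = (\<integral>\<^sup>+x. ennreal (\<bar>a\<bar> ^ DIM('a)) * indicator (truncated_cone B a) x \<partial>distr lborel borel (\<lambda>x. 0 + a *\<^sub>R x))"
    by (rule emeasure_density) simp_all
  also have "\<dots> = (\<integral>\<^sup>+x. ennreal (a ^ DIM('a)) * indicator (truncated_cone B 1) x \<partial>lborel)"
    using a by (subst nn_integral_distr) (simp_all add: vim indicator_def)
  also have "\<dots> = ennreal (a ^ DIM('a)) * emeasure lborel (truncated_cone B 1)"
    by (subst nn_integral_cmult) simp_all
  finally show ?thesis .
qed

lemma emeasure_radial_measure:
  "emeasure (radial_measure n) {..<a} = (if 0 < a then ennreal (a ^ Suc n / real (Suc n)) else 0)"
proof (cases "0 < a")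
  case True
  have "emeasure (radial_measure n) {..<a} = (\<integral>\<^sup>+r. ennreal (r ^ n) * indicator {0<..} r * indicator {..<a} r \<partial>lborel)"
    by (simp add: radial_measure_def emeasure_density)
  also have "\<dots> = (\<integral>\<^sup>+r. ennreal (r ^ n) * indicator {0..a} r \<partial>lborel)"
  proof (rule nn_integral_cong_AE)
    show "AE r in lborel. ennreal (r ^ n) * indicator {0<..} r * indicator {..<a} r = ennreal (r ^ n) * indicator {0..a} r"
      using AE_lborel_singleton[of 0] AE_lborel_singleton[of a] by eventually_elim (auto split: split_indicator)
  qed
  also have "\<dots> = ennreal (a ^ Suc n / real (Suc n) - 0 ^ Suc n / real (Suc n))"
  proof (rule nn_integral_FTC_Icc[where F="\<lambda>r. r ^ Suc n / real (Suc n)"])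
    show "((\<lambda>r. r ^ Suc n / real (Suc n)) has_real_derivative x ^ n) (at x)" for x
      by (rule DERIV_cong[OF DERIV_cdivide[OF DERIV_pow]]) (simp del: of_nat_Suc)
  qed (use True in auto)
  finally show ?thesis using True by simp
next
  case False
  have "emeasure (radial_measure n) {..<a} = (\<integral>\<^sup>+r. ennreal (r ^ n) * indicator {0<..} r * indicator {..<a} r \<partial>lborel)"
    by (simp add: radial_measure_def emeasure_density)
  also have "\<dots> = (\<integral>\<^sup>+(r::real). 0 \<partial>lborel)"
    by (rule nn_integral_cong) (use False in \<open>auto split: split_indicator\<close>)
  finally show ?thesis using False by simp
qed

text \<open>The polar formula on rectangles. Dilation contributes \<open>a ^ DIM('a)\<close>, and
  the dimension factor in \<open>sphere_measure\<close> cancels the \<open>1 / DIM('a)\<close> that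
  comes from integrating the radial weight.\<close>

lemma emeasure_truncated_cone_eq:
  assumes B: "B \<in> sets (sphere_measure :: 'a::euclidean_space measure)"
  shows "emeasure lborel (truncated_cone B a) = emeasure (radial_measure (DIM('a) - 1)) {..<a} * emeasure sphere_measure B"
proof (cases "0 < a")
  case True
  have D: "Suc (DIM('a) - 1) = DIM('a)" using DIM_positive[where 'a='a] by linarith
  have "emeasure (radial_measure (DIM('a) - 1)) {..<a} * emeasure sphere_measure B
    = ennreal (a ^ DIM('a) / real DIM('a)) * ennreal (real DIM('a)) * emeasure lborel (truncated_cone B 1)"
    unfolding emeasure_radial_measure emeasure_sphere_truncated_cone[OF B] D using True
    by (simp add: mult.assoc ennreal_of_nat_eq_real_of_nat)
  also have "ennreal (a ^ DIM('a) / real DIM('a)) * ennreal (real DIM('a)) = ennreal (a ^ DIM('a))"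
    using True by (subst ennreal_mult[symmetric]) auto
  finally show ?thesis by (simp add: emeasure_truncated_cone_scale[OF B True])
next
  case False
  then have "truncated_cone B a = {}"
    unfolding truncated_cone_def by (metis (no_types, lifting) Collect_empty_eq less_trans)
  then show ?thesis using False by (simp add: emeasure_radial_measure)
qed

lemma truncated_cone_UNIV: "truncated_cone (sphere 0 1) 1 = ball 0 1 - {0}"
  by (auto simp: truncated_cone_def norm_sgn)

lemma sphere_measure_finite: "emeasure (sphere_measure :: 'a::euclidean_space measure) (sphere 0 1) < \<infinity>"
proof -
  have "sphere 0 1 \<in> sets (sphere_measure :: 'a measure)" by (metis sets.top space_sphere_measure)
  moreover have "emeasure lborel (ball (0::'a) 1 - {0}) \<le> emeasure lborel (ball (0::'a) 1)"
    by (rule emeasure_mono) auto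
  ultimately show ?thesis using emeasure_lborel_ball_finite[of "0::'a" 1]
    by (auto simp: emeasure_sphere_truncated_cone truncated_cone_UNIV ennreal_mult_less_top ennreal_of_nat_eq_real_of_nat)
qed

text \<open>Together with \<open>sphere_measure_finite\<close> this lets the total mass be cancelled
  in \<open>log_radial_transfer\<close>. The unit ball keeps its positive volume when its centre is
  removed.\<close>

lemma sphere_measure_pos: "0 < emeasure (sphere_measure :: 'a::euclidean_space measure) (sphere 0 1)"
proof -
  have s: "sphere 0 1 \<in> sets (sphere_measure :: 'a measure)" by (metis sets.top space_sphere_measure)
  have "emeasure lborel (ball (0::'a) 1 - {0}) = emeasure lborel (ball (0::'a) 1) - emeasure lborel {0::'a}"
    by (rule emeasure_Diff) auto
  also have "\<dots> > 0" using content_ball_pos[of 1 "0::'a"]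
    by (simp add: measure_def enn2real_positive_iff)
  finally show ?thesis
    by (simp add: emeasure_sphere_truncated_cone[OF s] truncated_cone_UNIV ennreal_zero_less_mult_iff)
qed

lemma sphere_finite_measure: "finite_measure (sphere_measure :: 'a::euclidean_space measure)"
  by (rule finite_measureI) (use sphere_measure_finite[where 'a='a] in auto)

lemma radial_sigma_finite: "sigma_finite_measure (radial_measure n)"
  unfolding radial_measure_def
  by (subst sigma_finite_measure.sigma_finite_iff_density_finite[OF sigma_finite_lborel]) (auto intro!: AE_I2 simp: ennreal_mult_eq_top_iff split: split_indicator)

lemma polar_map_measurable:
  "(\<lambda>x::'a::euclidean_space. (norm x, sgn x)) \<in> restrict_space lborel (- {0}) \<rightarrow>\<^sub>M radial_measure n \<Otimes>\<^sub>M sphere_measure"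
    (is "_ \<in> ?L \<rightarrow>\<^sub>M ?P \<Otimes>\<^sub>M ?S")
proof (rule measurable_Pair)
  show "norm \<in> ?L \<rightarrow>\<^sub>M ?P" by (simp add: radial_measure_def measurable_restrict_space1)
  have "sgn \<in> ?L \<rightarrow>\<^sub>M restrict_space borel (sphere (0::'a) 1)"
    by (rule measurable_restrict_space2) (auto intro: measurable_restrict_space1 simp: space_restrict_space norm_sgn)
  then show "sgn \<in> ?L \<rightarrow>\<^sub>M ?S" by (simp cong: measurable_cong_sets add: sets_sphere_measure)
qed

text \<open>A sigma-finite product measure is determined by its values on rectangles. With
  \<open>B\<close> fixed, both sides are measures in \<open>A\<close>, so it is enough to compare
  them on half-lines, where \<open>emeasure_truncated_cone_eq\<close> applies.\<close>

lemma distr_polar: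
  "radial_measure (DIM('a) - 1) \<Otimes>\<^sub>M (sphere_measure :: 'a::euclidean_space measure)
    = distr (restrict_space lborel (- {0})) (radial_measure (DIM('a) - 1) \<Otimes>\<^sub>M sphere_measure) (\<lambda>x. (norm x, sgn x))"
    (is "?P \<Otimes>\<^sub>M ?S = distr ?L _ ?T")
proof -
  note T = polar_map_measurable
  interpret P: sigma_finite_measure ?P by (rule radial_sigma_finite)
  interpret S: finite_measure ?S by (rule sphere_finite_measure)
  show ?thesis
  proof (rule pair_measure_eqI)
    fix A B assume A: "A \<in> sets ?P" and B: "B \<in> sets ?S"
    have [measurable]: "B \<in> sets borel" using B by (auto simp: sets_sphere_measure sets_restrict_space_iff)
    define C where "C = {x::'a. x \<noteq> 0 \<and> sgn x \<in> B}"
    have C [measurable]: "C \<in> sets borel"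
    proof -
      have "C = {x \<in> space borel. x \<noteq> 0 \<and> sgn x \<in> B}" by (simp add: C_def)
      also have "\<dots> \<in> sets borel" by measurable
      finally show ?thesis .
    qed
    \<comment> \<open>The distribution of the norm on the infinite cone over \<open>B\<close>; its
      value on \<open>A\<close> is the mass that the polar map sends into \<open>A\<close> times
      \<open>B\<close>.\<close>
    define \<nu> where "\<nu> = distr (density lborel (indicator C)) borel (norm :: 'a \<Rightarrow> real)"
    have \<nu>: "emeasure \<nu> X = emeasure lborel {x \<in> C. norm x \<in> X}" if [measurable]: "X \<in> sets borel" for X
    proof -
      have [measurable]: "(norm :: 'a \<Rightarrow> real) -` X \<in> sets borel"
        by (rule measurable_sets_borel[OF _ that]) simp
      have "emeasure \<nu> X = (\<integral>\<^sup>+x. indicator C x * indicator (norm -` X) x \<partial>lborel)"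
        unfolding \<nu>_def by (subst emeasure_distr) (simp_all add: emeasure_density)
      also have "\<dots> = (\<integral>\<^sup>+x. indicator {x \<in> C. norm x \<in> X} x \<partial>lborel)"
        by (intro nn_integral_cong) (auto split: split_indicator)
      also have "\<dots> = emeasure lborel {x \<in> C. norm x \<in> X}"
      proof (rule nn_integral_indicator)
        have "{x \<in> C. norm x \<in> X} = {x \<in> space borel. x \<in> C \<and> norm x \<in> X}" by simp
        also have "\<dots> \<in> sets borel" by measurable
        finally show "{x \<in> C. norm x \<in> X} \<in> sets lborel" by simp
      qed
      finally show ?thesis .
    qed
    have "\<nu> = scale_measure (emeasure ?S B) ?P"
    proof (rule measure_eqI_generator_eq[where E="range (lessThan :: real \<Rightarrow> _)" and \<Omega>=UNIV and A="\<lambda>i. {..<real i}"])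
      show "Int_stable (range (lessThan :: real \<Rightarrow> _))"
      proof -
        have "{..<x} \<inter> {..<y} = {..<min x y}" for x y :: real by auto
        then show ?thesis by (simp add: Int_stable_def)
      qed
      show "emeasure \<nu> X = emeasure (scale_measure (emeasure ?S B) ?P) X" if X_range: "X \<in> range (lessThan :: real \<Rightarrow> _)" for X
      proof -
        obtain a where X: "X = {..<a}" using X_range by auto
        have "{x \<in> C. norm x \<in> X} = truncated_cone B a" by (auto simp: C_def truncated_cone_def X)
        then show ?thesis by (simp add: \<nu> X emeasure_truncated_cone_eq[OF B] mult.commute)
      qed
      show "sets \<nu> = sigma_sets UNIV (range lessThan)"
        by (simp add: \<nu>_def borel_Iio)
      show "sets (scale_measure (emeasure ?S B) ?P) = sigma_sets UNIV (range lessThan)"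
        by (simp add: radial_measure_def borel_Iio)
      show "(\<Union>i. {..<real i}) = UNIV" using reals_Archimedean2 by auto
      show "emeasure \<nu> {..<real i} \<noteq> \<infinity>" for i
      proof -
        have "{x \<in> C. norm x \<in> {..<real i}} = truncated_cone B (real i)" by (auto simp: C_def truncated_cone_def)
        moreover have "emeasure lborel (truncated_cone B (real i)) \<noteq> \<infinity>"
          using S.emeasure_finite[of B] by (simp add: emeasure_truncated_cone_eq[OF B] emeasure_radial_measure ennreal_mult_eq_top_iff)
        ultimately show ?thesis by (simp add: \<nu>)
      qed
    qed auto
    then have "emeasure \<nu> A = emeasure ?P A * emeasure ?S B" using A by (simp add: mult.commute)
    moreover have "emeasure (distr ?L (?P \<Otimes>\<^sub>M ?S) ?T) (A \<times> B) = emeasure \<nu> A"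
    proof -
      have [measurable]: "A \<in> sets borel" using A by (simp add: radial_measure_def)
      have "emeasure (distr ?L (?P \<Otimes>\<^sub>M ?S) ?T) (A \<times> B) = emeasure ?L (?T -` (A \<times> B) \<inter> space ?L)"
        by (rule emeasure_distr[OF T]) (use A B in auto)
      also have "?T -` (A \<times> B) \<inter> space ?L = {x \<in> C. norm x \<in> A}"
        by (auto simp: C_def space_restrict_space)
      also have "emeasure ?L \<dots> = emeasure lborel {x \<in> C. norm x \<in> A}"
        by (rule emeasure_restrict_space) (auto simp: C_def)
      finally show ?thesis by (simp add: \<nu>)
    qed
    ultimately show "emeasure ?P A * emeasure ?S B = emeasure (distr ?L (?P \<Otimes>\<^sub>M ?S) ?T) (A \<times> B)" by simp
  qed (use P.sigma_finite_measure_axioms S.sigma_finite_measure_axioms in simp_all)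
qed

lemma nn_integral_radial_measure:
  assumes [measurable]: "f \<in> borel_measurable borel"
  shows "(\<integral>\<^sup>+r. f r \<partial>radial_measure n) = (\<integral>\<^sup>+r. ennreal (r ^ n) * f r * indicator {0<..} r \<partial>lborel)"
  unfolding radial_measure_def by (subst nn_integral_density) (auto simp: mult_ac)

lemma id_sphere_measurable: "(\<lambda>\<sigma>. \<sigma>) \<in> (sphere_measure :: 'a::euclidean_space measure) \<rightarrow>\<^sub>M borel"
  by (simp cong: measurable_cong_sets add: sets_sphere_measure measurable_restrict_space1)

lemma polar_measurable:
  fixes f :: "'a::euclidean_space \<Rightarrow> ennreal"
  assumes [measurable]: "f \<in> borel_measurable borel"
  shows "(\<lambda>(r, \<sigma>). f (r *\<^sub>R \<sigma>)) \<in> borel_measurable (borel \<Otimes>\<^sub>M sphere_measure)"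
proof -
  note [measurable] = id_sphere_measurable
  show ?thesis by measurable
qed

text \<open>Off the null set \<open>{0}\<close> every \<open>x\<close> is
  \<open>norm x *\<^sub>R sgn x\<close>, so the integrand is a function of the polar pair, and
  \<open>distr_polar\<close> with Tonelli applies.\<close>

lemma nn_integral_polar:
  fixes f :: "'a::euclidean_space \<Rightarrow> ennreal"
  assumes [measurable]: "f \<in> borel_measurable borel"
  shows "(\<integral>\<^sup>+x. f x \<partial>lborel)
    = (\<integral>\<^sup>+r. ennreal (r ^ (DIM('a) - 1)) * (\<integral>\<^sup>+\<sigma>. f (r *\<^sub>R \<sigma>) \<partial>sphere_measure) * indicator {0<..} r \<partial>lborel)"
proof -
  interpret S: finite_measure "sphere_measure :: 'a measure" by (rule sphere_finite_measure)
  let ?P = "radial_measure (DIM('a) - 1)" and ?S = "sphere_measure :: 'a measure"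
  let ?L = "restrict_space lborel (- {0::'a})" and ?T = "\<lambda>x::'a. (norm x, sgn x)"
  note pm = polar_measurable[OF assms]
  have pm': "(\<lambda>(r, \<sigma>). f (r *\<^sub>R \<sigma>)) \<in> borel_measurable (?P \<Otimes>\<^sub>M ?S)"
    using pm by (simp add: radial_measure_def cong: measurable_cong_sets sets_pair_measure_cong)
  note T = polar_map_measurable
  have "(\<integral>\<^sup>+r. ennreal (r ^ (DIM('a) - 1)) * (\<integral>\<^sup>+\<sigma>. f (r *\<^sub>R \<sigma>) \<partial>?S) * indicator {0<..} r \<partial>lborel)
    = (\<integral>\<^sup>+r. (\<integral>\<^sup>+\<sigma>. f (r *\<^sub>R \<sigma>) \<partial>?S) \<partial>?P)"
  proof (rule nn_integral_radial_measure[symmetric])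
    show "(\<lambda>r. \<integral>\<^sup>+\<sigma>. f (r *\<^sub>R \<sigma>) \<partial>?S) \<in> borel_measurable borel"
      using S.borel_measurable_nn_integral[OF pm] by simp
  qed
  also have "\<dots> = (\<integral>\<^sup>+z. (case z of (r, \<sigma>) \<Rightarrow> f (r *\<^sub>R \<sigma>)) \<partial>(?P \<Otimes>\<^sub>M ?S))"
    using S.nn_integral_fst[OF pm'] by simp
  also have "\<dots> = (\<integral>\<^sup>+z. (case z of (r, \<sigma>) \<Rightarrow> f (r *\<^sub>R \<sigma>)) \<partial>distr ?L (?P \<Otimes>\<^sub>M ?S) ?T)"
    by (simp only: distr_polar[symmetric])
  also have "\<dots> = (\<integral>\<^sup>+x. f (norm x *\<^sub>R sgn x) \<partial>?L)"
    by (subst nn_integral_distr[OF T]) (use pm' in simp_all)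
  also have "\<dots> = (\<integral>\<^sup>+x. f (norm x *\<^sub>R sgn x) * indicator (- {0}) x \<partial>lborel)"
    by (rule nn_integral_restrict_space) auto
  also have "\<dots> = (\<integral>\<^sup>+x. f x \<partial>lborel)"
  proof (rule nn_integral_cong_AE)
    show "AE x in lborel. f (norm x *\<^sub>R sgn x) * indicator (- {0}) x = f x"
      using AE_lborel_singleton[of "0::'a"] by eventually_elim (simp add: sgn_div_norm)
  qed
  finally show ?thesis by simp
qed

subsection \<open>Reduction to rays\<close>

text \<open>\<open>grad\<close> is a definite description, so a gradient must be exhibited and shown
  unique: the vector of partial derivatives represents the derivative, and a vector is determined by
  its inner products.\<close>

lemma inner_grad:
  fixes u :: "'a::euclidean_space \<Rightarrow> real"
  assumes "u differentiable (at x)"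
  shows "h \<bullet> grad u x = frechet_derivative u (at x) h"
proof -
  have der: "(u has_derivative frechet_derivative u (at x)) (at x)"
    using assms by (simp add: frechet_derivative_works)
  then interpret bounded_linear "frechet_derivative u (at x)" by (rule has_derivative_bounded_linear)
  define D where "D = (\<Sum>b\<in>Basis. frechet_derivative u (at x) b *\<^sub>R b)"
  have D: "h \<bullet> D = frechet_derivative u (at x) h" for h
  proof -
    have "frechet_derivative u (at x) h = frechet_derivative u (at x) (\<Sum>b\<in>Basis. (h \<bullet> b) *\<^sub>R b)"
      by (simp add: euclidean_representation)
    then show ?thesis by (simp add: D_def inner_sum_right sum scale mult.commute)
  qed
  have "grad u x = D"
    unfolding grad_def
  proof (rule the_equality)
    show "GDERIV u x :> D" using der by (simp add: gderiv_def D)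
    fix E assume "GDERIV u x :> E"
    then have "(u has_derivative (\<lambda>h. h \<bullet> E)) (at x)" by (simp add: gderiv_def)
    then have "frechet_derivative u (at x) = (\<lambda>h. h \<bullet> E)" using der has_derivative_unique by blast
    then have "h \<bullet> D = h \<bullet> E" for h using D[of h] by simp
    then show "E = D" by (metis euclidean_eqI inner_commute)
  qed
  then show ?thesis by (simp add: D)
qed

lemma continuous_on_grad:
  fixes u :: "'a::euclidean_space \<Rightarrow> real"
  assumes "smooth u"
  shows "continuous_on UNIV (grad u)"
proof -
  have "C_differentiable (Suc 0) u" using assms by (simp add: smooth_def del: C_differentiable.simps)
  then have diff: "u differentiable (at x)"
    and cont: "b \<in> Basis \<Longrightarrow> continuous_on UNIV (\<lambda>x. frechet_derivative u (at x) b)" for x b by auto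
  have "grad u = (\<lambda>x. \<Sum>b\<in>Basis. frechet_derivative u (at x) b *\<^sub>R b)"
    by (rule ext, rule euclidean_eqI) (simp add: inner_commute[of "grad u _"] inner_grad[OF diff])
  then show ?thesis by (rule ssubst) (intro continuous_intros cont)
qed

text \<open>The closed support \<open>K\<close> misses a ball around 0 and lies in a large one. The
  gradient vanishes off \<open>K\<close> as well, because the complement of \<open>K\<close> is open
  and \<open>u\<close> is zero on it.\<close>

lemma test_function_annulus:
  fixes u :: "'a::euclidean_space \<Rightarrow> real"
  assumes "u \<in> test_functions_punctured"
  obtains \<delta> R where "0 < \<delta>" "\<And>x. norm x \<le> \<delta> \<Longrightarrow> u x = 0 \<and> grad u x = 0" "\<And>x. R \<le> norm x \<Longrightarrow> u x = 0 \<and> grad u x = 0"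
proof -
  define K where "K = closure (support_on UNIV u)"
  have K: "compact K" "0 \<notin> K" using assms by (auto simp: test_functions_punctured_def K_def)
  have off: "u x = 0 \<and> grad u x = 0" if "x \<notin> K" for x
  proof
    have z: "u y = 0" if "y \<in> - K" for y
      using that closure_subset[of "support_on UNIV u"] by (auto simp: K_def support_on_def)
    show "u x = 0" using z that by simp
    have "((\<lambda>_. 0::real) has_derivative (\<lambda>_. 0)) (at x)" by simp
    then have der: "(u has_derivative (\<lambda>_. 0)) (at x)"
      by (rule has_derivative_transform_within_open[of _ _ _ _ "- K"]) (use that z K in \<open>auto intro: compact_imp_closed\<close>)
    then have "grad u x \<bullet> grad u x = 0"
      by (subst inner_grad) (auto simp: differentiable_def frechet_derivative_at[OF der, symmetric])
    then show "grad u x = 0" by simp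
  qed
  obtain B where B: "\<And>x. x \<in> K \<Longrightarrow> norm x \<le> B" using compact_imp_bounded[OF K(1)] by (auto simp: bounded_iff)
  have "open (- K)" using K compact_imp_closed by blast
  then obtain e where e: "e > 0" "ball 0 e \<subseteq> - K" using K(2) open_contains_ball[of "- K"] by auto
  show thesis
  proof
    \<comment> \<open>The closed ball of radius \<open>e / 2\<close> fits inside the open one, and
      \<open>B + 1\<close> below excludes points of \<open>K\<close> with norm exactly
      \<open>B\<close>.\<close>
    show "0 < e / 2" using e by simp
    show "u x = 0 \<and> grad u x = 0" if "norm x \<le> e / 2" for x
    proof (rule off)
      have "x \<in> ball 0 e" using that e by simp
      then show "x \<notin> K" using e by blast
    qed
    show "u x = 0 \<and> grad u x = 0" if "B + 1 \<le> norm x" for x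
      using that B[of x] by (intro off) auto
  qed
qed

text \<open>The truncation \<open>max 0 t\<close> keeps the ray from running through the origin into the opposite direction.\<close>

definition ray_profile :: "('a::euclidean_space \<Rightarrow> real) \<Rightarrow> 'a \<Rightarrow> real \<Rightarrow> real"
  where "ray_profile u \<sigma> t = \<bar>\<sigma> \<bullet> grad u (max 0 t *\<^sub>R \<sigma>)\<bar>"

definition ray_maximal :: "('a::euclidean_space \<Rightarrow> real) \<Rightarrow> 'a \<Rightarrow> real \<Rightarrow> real"
  where "ray_maximal u \<sigma> = hardy_profile.M0 (ray_profile u \<sigma>)"

text \<open>The bounds come from the annulus around the support, so one pair
  \<open>\<delta>\<close>, \<open>R\<close> serves all directions.\<close>

lemma hardy_profile_ray:
  fixes u :: "'a::euclidean_space \<Rightarrow> real"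
  assumes "u \<in> test_functions_punctured"
  obtains \<delta> R where "\<And>\<sigma>. norm \<sigma> = 1 \<Longrightarrow> hardy_profile (ray_profile u \<sigma>) \<delta> R"
proof -
  obtain \<delta> R where d: "0 < \<delta>" "\<And>x. norm x \<le> \<delta> \<Longrightarrow> u x = 0 \<and> grad u x = 0" "\<And>x. R \<le> norm x \<Longrightarrow> u x = 0 \<and> grad u x = 0"
    using test_function_annulus[OF assms] by metis
  have "smooth u" using assms by (simp add: test_functions_punctured_def)
  from continuous_on_grad[OF this] have cont: "continuous_on UNIV (grad u)" .
  have "hardy_profile (ray_profile u \<sigma>) \<delta> R" if "norm \<sigma> = 1" for \<sigma>
  proof
    show "continuous_on UNIV (ray_profile u \<sigma>)"
      unfolding ray_profile_def[abs_def]
      by (intro continuous_intros continuous_on_compose2[OF cont]) auto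
  qed (use that d in \<open>auto simp: ray_profile_def\<close>)
  then show thesis using that by blast
qed

text \<open>The fundamental theorem along the ray, starting from the origin, where \<open>u\<close>
  vanishes. On \<open>{0..s}\<close> the truncation in \<open>ray_profile\<close> has no
  effect.\<close>

lemma abs_le_ray_integral:
  fixes u :: "'a::euclidean_space \<Rightarrow> real"
  assumes u: "u \<in> test_functions_punctured" and s: "0 \<le> s"
  shows "\<bar>u (s *\<^sub>R \<sigma>)\<bar> \<le> integral {0..s} (ray_profile u \<sigma>)"
proof -
  have sm: "smooth u" using u by (simp add: test_functions_punctured_def)
  have cont: "continuous_on UNIV (grad u)" by (rule continuous_on_grad[OF sm])
  have "C_differentiable (Suc 0) u" using sm by (simp add: smooth_def del: C_differentiable.simps)
  then have diff: "u differentiable (at x)" for x by auto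
  have u0: "u 0 = 0" using test_function_annulus[OF u] by (metis less_imp_le norm_zero)
  have "((\<lambda>t. \<sigma> \<bullet> grad u (t *\<^sub>R \<sigma>)) has_integral u (s *\<^sub>R \<sigma>) - u (0 *\<^sub>R \<sigma>)) {0..s}"
  proof (rule fundamental_theorem_of_calculus[OF s])
    fix t
    have "((\<lambda>t. t *\<^sub>R \<sigma>) has_derivative (\<lambda>h. h *\<^sub>R \<sigma>)) (at t within {0..s})"
      by (auto intro!: derivative_eq_intros)
    moreover have "(u has_derivative frechet_derivative u (at (t *\<^sub>R \<sigma>))) (at (t *\<^sub>R \<sigma>))"
      using diff by (simp add: frechet_derivative_works)
    ultimately have "((\<lambda>t. u (t *\<^sub>R \<sigma>)) has_derivative (\<lambda>h. frechet_derivative u (at (t *\<^sub>R \<sigma>)) (h *\<^sub>R \<sigma>))) (at t within {0..s})"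
      by (rule has_derivative_compose)
    moreover have "(\<lambda>h. frechet_derivative u (at (t *\<^sub>R \<sigma>)) (h *\<^sub>R \<sigma>)) = (\<lambda>h. h *\<^sub>R (\<sigma> \<bullet> grad u (t *\<^sub>R \<sigma>)))"
      by (simp flip: inner_grad[OF diff])
    ultimately show "((\<lambda>t. u (t *\<^sub>R \<sigma>)) has_vector_derivative \<sigma> \<bullet> grad u (t *\<^sub>R \<sigma>)) (at t within {0..s})"
      by (simp add: has_vector_derivative_def)
  qed
  then have I: "integral {0..s} (\<lambda>t. \<sigma> \<bullet> grad u (t *\<^sub>R \<sigma>)) = u (s *\<^sub>R \<sigma>)"
    and i: "(\<lambda>t. \<sigma> \<bullet> grad u (t *\<^sub>R \<sigma>)) integrable_on {0..s}"
    using u0 by (auto simp: integral_unique integrable_on_def)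
  have "norm (integral {0..s} (\<lambda>t. \<sigma> \<bullet> grad u (t *\<^sub>R \<sigma>))) \<le> integral {0..s} (ray_profile u \<sigma>)"
  proof (rule integral_norm_bound_integral[OF i])
    show "ray_profile u \<sigma> integrable_on {0..s}"
      unfolding ray_profile_def[abs_def]
      by (intro integrable_continuous_real continuous_intros continuous_on_compose2[OF cont]) auto
  qed (auto simp: ray_profile_def)
  then show ?thesis using I by simp
qed

text \<open>In the first bound \<open>s <= r\<close>, so monotonicity raises the numerator to
  \<open>G r\<close>, and \<open>G r / r\<close> competes in the supremum defining
  \<open>M r\<close>; in the second bound \<open>G s / s\<close> itself does. Hence one maximal
  function controls both suprema.\<close>

lemma ray_maximal_bounds:
  fixes u :: "'a::euclidean_space \<Rightarrow> real"
  assumes u: "u \<in> test_functions_punctured" and \<sigma>: "norm \<sigma> = 1"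
  shows "0 < s \<Longrightarrow> s \<le> r \<Longrightarrow> \<bar>u (s *\<^sub>R \<sigma>)\<bar> / r \<le> ray_maximal u \<sigma> r"
    and "0 < r \<Longrightarrow> r \<le> s \<Longrightarrow> \<bar>u (s *\<^sub>R \<sigma>)\<bar> / s \<le> ray_maximal u \<sigma> r"
proof -
  obtain \<delta> R where "hardy_profile (ray_profile u \<sigma>) \<delta> R" using hardy_profile_ray[OF u] \<sigma> by metis
  then interpret H: hardy_profile "ray_profile u \<sigma>" \<delta> R .
  have G: "\<bar>u (t *\<^sub>R \<sigma>)\<bar> \<le> H.G t" if "0 < t" for t
    using abs_le_ray_integral[OF u, of t] that by (simp add: H.G_def)
  show "\<bar>u (s *\<^sub>R \<sigma>)\<bar> / r \<le> ray_maximal u \<sigma> r" if "0 < s" "s \<le> r"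
  proof -
    have "\<bar>u (s *\<^sub>R \<sigma>)\<bar> / r \<le> H.G r / r"
      using that G[of s] H.G_mono[of s r] by (intro divide_right_mono) auto
    also have "\<dots> \<le> ray_maximal u \<sigma> r" using that H.ratio_le_M[of r r] by (simp add: ray_maximal_def H.M0_def)
    finally show ?thesis .
  qed
  show "\<bar>u (s *\<^sub>R \<sigma>)\<bar> / s \<le> ray_maximal u \<sigma> r" if "0 < r" "r \<le> s"
  proof -
    have "\<bar>u (s *\<^sub>R \<sigma>)\<bar> / s \<le> H.G s / s"
      using that G[of s] by (intro divide_right_mono) auto
    also have "\<dots> \<le> ray_maximal u \<sigma> r" using that H.ratio_le_M[of r s] by (simp add: ray_maximal_def H.M0_def)
    finally show ?thesis .
  qed
qed

section \<open>Joint measurability of the maximal function\<close>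

context hardy_profile begin

text \<open>By continuity a ratio above \<open>c\<close> at \<open>s\<close> stays above
  \<open>c\<close> at some rational number slightly to the right of \<open>s\<close>, which is still
  at least \<open>r\<close>. The supremum thus becomes countable.\<close>

lemma less_M0_iff_rat:
  "c < M0 r \<longleftrightarrow> r \<le> 0 \<and> c < 0 \<or> 0 < r \<and> (\<exists>q::rat. r \<le> of_rat q \<and> c < G (of_rat q) / of_rat q)"
proof (cases "0 < r")
  case True
  have "\<exists>q::rat. r \<le> of_rat q \<and> c < G (of_rat q) / of_rat q" if s: "r \<le> s" "c < G s / s" for s
  proof -
    have "isCont (\<lambda>s. G s / s) s" by (intro continuous_intros G_isCont) (use s True in auto)
    then have "((\<lambda>s. G s / s) \<longlongrightarrow> G s / s) (nhds s)"
      using tendsto_at_iff_tendsto_nhds[of "\<lambda>s. G s / s" s] by (simp add: isCont_def)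
    then have "\<forall>\<^sub>F x in nhds s. c < G x / x" by (rule order_tendstoD(1)) (rule s)
    then obtain e where e: "e > 0" "\<And>x. dist x s < e \<Longrightarrow> c < G x / x"
      by (auto simp: eventually_nhds_metric)
    obtain q :: rat where "s < of_rat q" "of_rat q < s + e" using of_rat_dense[of s "s + e"] e by auto
    then show ?thesis using s e(2)[of "of_rat q"] by (intro exI[of _ q]) (auto simp: dist_real_def)
  qed
  then show ?thesis using True less_M_iff[OF True, of c] by (auto simp: M0_def)
qed (auto simp: M0_def)

end

text \<open>Tonelli needs measurability in radius and direction together. By
  \<open>less_M0_iff_rat\<close> the superlevel sets are built from countably many conditions, one
  for each rational upper limit, on integrals that are continuous in
  \<open>\<sigma>\<close>.\<close>

lemma ray_maximal_measurable:
  fixes u :: "'a::euclidean_space \<Rightarrow> real"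
  assumes u: "u \<in> test_functions_punctured"
  shows "(\<lambda>(r, \<sigma>). ray_maximal u \<sigma> r) \<in> borel_measurable (lborel \<Otimes>\<^sub>M sphere_measure)"
proof -
  note [measurable] = id_sphere_measurable
  have "smooth u" using u by (simp add: test_functions_punctured_def)
  from continuous_on_grad[OF this] have cont: "continuous_on UNIV (grad u)" .
  define I where "I q \<sigma> = integral {0..q} (ray_profile u \<sigma>)" for q \<sigma>
  have [measurable]: "I q \<in> borel_measurable borel" for q
  proof (rule borel_measurable_continuous_onI)
    have "continuous_on UNIV (\<lambda>\<sigma>. integral (cbox 0 q) (ray_profile u \<sigma>))"
    proof (rule integral_continuous_on_param)
      show "continuous_on (UNIV \<times> cbox 0 q) (\<lambda>(\<sigma>, t). ray_profile u \<sigma> t)"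
        unfolding ray_profile_def split_def
        by (intro continuous_intros continuous_on_compose2[OF cont]) auto
    qed
    then show "continuous_on UNIV (I q)" by (simp add: I_def[abs_def])
  qed
  obtain \<delta> R where H: "\<And>\<sigma>. norm \<sigma> = 1 \<Longrightarrow> hardy_profile (ray_profile u \<sigma>) \<delta> R" using hardy_profile_ray[OF u] by metis
  have iff: "c < ray_maximal u \<sigma> r \<longleftrightarrow> r \<le> 0 \<and> c < 0 \<or> 0 < r \<and> (\<exists>q::rat. r \<le> of_rat q \<and> c < I (of_rat q) \<sigma> / of_rat q)"
    if "norm \<sigma> = 1" for c r \<sigma>
  proof -
    interpret H: hardy_profile "ray_profile u \<sigma>" \<delta> R using that by (rule H)
    show ?thesis unfolding ray_maximal_def I_def using H.less_M0_iff_rat by (simp add: H.G_def)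
  qed
  show ?thesis
  proof (rule borel_measurable_iff_greater[THEN iffD2], rule allI)
    fix c
    have "{w \<in> space (lborel \<Otimes>\<^sub>M (sphere_measure :: 'a measure)). c < (case w of (r, \<sigma>) \<Rightarrow> ray_maximal u \<sigma> r)}
       = {w \<in> space (lborel \<Otimes>\<^sub>M (sphere_measure :: 'a measure)). fst w \<le> 0 \<and> c < 0 \<or>
            0 < fst w \<and> (\<exists>q::rat. fst w \<le> of_rat q \<and> c < I (of_rat q) (snd w) / of_rat q)}"
      by (auto simp: space_pair_measure iff)
    also have "\<dots> \<in> sets (lborel \<Otimes>\<^sub>M sphere_measure)" by measurable
    finally show "{w \<in> space (lborel \<Otimes>\<^sub>M (sphere_measure :: 'a measure)). c < (case w of (r, \<sigma>) \<Rightarrow> ray_maximal u \<sigma> r)}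
      \<in> sets (lborel \<Otimes>\<^sub>M sphere_measure)" .
  qed
qed

text \<open>Tonelli brings the radial integral inside, \<open>maximal_Hardy\<close> acts on each ray
  with \<open>m = DIM('a) - 1\<close>, and Tonelli with \<open>nn_integral_polar\<close> reassembles
  the energy.\<close>

lemma ray_maximal_energy:
  fixes u :: "'a::euclidean_space \<Rightarrow> real"
  assumes u: "u \<in> test_functions_punctured" and p: "real DIM('a) < p"
  shows "(\<integral>\<^sup>+r. ennreal (r ^ (DIM('a) - 1)) * (\<integral>\<^sup>+\<sigma>. ennreal (ray_maximal u \<sigma> r powr p) \<partial>sphere_measure) * indicator {0<..} r \<partial>lborel)
    \<le> ennreal ((p / (p - real DIM('a))) powr p) * radial_energy p u"
proof -
  define m where "m = DIM('a) - 1"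
  have m: "Suc m = DIM('a)" using DIM_positive[where 'a='a] by (simp add: m_def)
  let ?S = "sphere_measure :: 'a measure"
  interpret S: finite_measure ?S by (rule sphere_finite_measure)
  interpret pair_sigma_finite lborel ?S ..
  note [measurable] = id_sphere_measurable ray_maximal_measurable[OF u]
  have "smooth u" using u by (simp add: test_functions_punctured_def)
  from continuous_on_grad[OF this] have cont: "continuous_on UNIV (grad u)" .
  have [measurable]: "grad u \<in> borel_measurable borel" by (rule borel_measurable_continuous_onI[OF cont])
  obtain \<delta> R where H: "\<And>\<sigma>. norm \<sigma> = 1 \<Longrightarrow> hardy_profile (ray_profile u \<sigma>) \<delta> R" using hardy_profile_ray[OF u] by metis
  let ?K = "ennreal ((p / (p - real DIM('a))) powr p)"
  define g where "g r \<sigma> = ennreal (r ^ m * ray_profile u \<sigma> r powr p) * indicator {0<..} r" for r \<sigma>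
  have "continuous_on UNIV (\<lambda>z. ray_profile u (snd z) (fst z))"
    unfolding ray_profile_def by (intro continuous_intros continuous_on_compose2[OF cont]) auto
  then have [measurable]: "(\<lambda>z. ray_profile u (snd z) (fst z)) \<in> borel_measurable (borel \<Otimes>\<^sub>M borel)"
    by (simp add: borel_prod borel_measurable_continuous_onI)
  have rp: "(\<lambda>(r, \<sigma>). ray_profile u \<sigma> r) \<in> borel_measurable (lborel \<Otimes>\<^sub>M ?S)"
  proof -
    have "(\<lambda>z. (fst z, snd z)) \<in> lborel \<Otimes>\<^sub>M ?S \<rightarrow>\<^sub>M borel \<Otimes>\<^sub>M borel" by measurable
    from measurable_compose[OF this, of "\<lambda>z. ray_profile u (snd z) (fst z)" borel] show ?thesis
      by (simp add: split_def)
  qed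
  note [measurable] = rp
  have g [measurable]: "(\<lambda>(r, \<sigma>). g r \<sigma>) \<in> borel_measurable (lborel \<Otimes>\<^sub>M ?S)" unfolding g_def by measurable
  have "(\<integral>\<^sup>+r. ennreal (r ^ m) * (\<integral>\<^sup>+\<sigma>. ennreal (ray_maximal u \<sigma> r powr p) \<partial>?S) * indicator {0<..} r \<partial>lborel)
     = (\<integral>\<^sup>+r. (\<integral>\<^sup>+\<sigma>. ennreal (r ^ m * ray_maximal u \<sigma> r powr p) * indicator {0<..} r \<partial>?S) \<partial>lborel)"
  proof (rule nn_integral_cong)
    fix r :: real
    show "ennreal (r ^ m) * (\<integral>\<^sup>+\<sigma>. ennreal (ray_maximal u \<sigma> r powr p) \<partial>?S) * indicator {0<..} r
       = (\<integral>\<^sup>+\<sigma>. ennreal (r ^ m * ray_maximal u \<sigma> r powr p) * indicator {0<..} r \<partial>?S)"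
    proof (cases "0 < r")
      case True
      have "(\<lambda>\<sigma>. ray_maximal u \<sigma> r) \<in> borel_measurable ?S" by measurable
      then show ?thesis using True by (simp add: ennreal_mult nn_integral_cmult)
    qed simp
  qed
  also have "\<dots> = (\<integral>\<^sup>+\<sigma>. (\<integral>\<^sup>+r. ennreal (r ^ m * ray_maximal u \<sigma> r powr p) * indicator {0<..} r \<partial>lborel) \<partial>?S)"
    by (rule Fubini'[symmetric]) measurable
  also have "\<dots> \<le> (\<integral>\<^sup>+\<sigma>. ?K * (\<integral>\<^sup>+r. g r \<sigma> \<partial>lborel) \<partial>?S)"
  proof (rule nn_integral_mono)
    fix \<sigma> assume "\<sigma> \<in> space ?S"
    then interpret H: hardy_profile "ray_profile u \<sigma>" \<delta> R by (intro H) simp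
    show "(\<integral>\<^sup>+r. ennreal (r ^ m * ray_maximal u \<sigma> r powr p) * indicator {0<..} r \<partial>lborel) \<le> ?K * (\<integral>\<^sup>+r. g r \<sigma> \<partial>lborel)"
      using H.maximal_Hardy[of m p] p unfolding m ray_maximal_def g_def by simp
  qed
  also have "\<dots> = ?K * (\<integral>\<^sup>+\<sigma>. (\<integral>\<^sup>+r. g r \<sigma> \<partial>lborel) \<partial>?S)"
    by (rule nn_integral_cmult) measurable
  also have "(\<integral>\<^sup>+\<sigma>. (\<integral>\<^sup>+r. g r \<sigma> \<partial>lborel) \<partial>?S) = (\<integral>\<^sup>+r. (\<integral>\<^sup>+\<sigma>. g r \<sigma> \<partial>?S) \<partial>lborel)"
    by (rule Fubini') measurable
  also have "\<dots> = radial_energy p u"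
  proof -
    have "radial_energy p u = (\<integral>\<^sup>+r. ennreal (r ^ m) *
        (\<integral>\<^sup>+\<sigma>. ennreal (\<bar>((r *\<^sub>R \<sigma>) /\<^sub>R norm (r *\<^sub>R \<sigma>)) \<bullet> grad u (r *\<^sub>R \<sigma>)\<bar> powr p) \<partial>?S) * indicator {0<..} r \<partial>lborel)"
      unfolding radial_energy_def m_def by (rule nn_integral_polar) measurable
    also have "\<dots> = (\<integral>\<^sup>+r. (\<integral>\<^sup>+\<sigma>. g r \<sigma> \<partial>?S) \<partial>lborel)"
    proof (rule nn_integral_cong)
      fix r :: real
      show "ennreal (r ^ m) * (\<integral>\<^sup>+\<sigma>. ennreal (\<bar>((r *\<^sub>R \<sigma>) /\<^sub>R norm (r *\<^sub>R \<sigma>)) \<bullet> grad u (r *\<^sub>R \<sigma>)\<bar> powr p) \<partial>?S) * indicator {0<..} r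
         = (\<integral>\<^sup>+\<sigma>. g r \<sigma> \<partial>?S)"
      proof (cases "0 < r")
        case True
        have [measurable]: "(\<lambda>\<sigma>. ray_profile u \<sigma> r) \<in> borel_measurable ?S" by measurable
        have "(\<integral>\<^sup>+\<sigma>. ennreal (\<bar>((r *\<^sub>R \<sigma>) /\<^sub>R norm (r *\<^sub>R \<sigma>)) \<bullet> grad u (r *\<^sub>R \<sigma>)\<bar> powr p) \<partial>?S)
          = (\<integral>\<^sup>+\<sigma>. ennreal (ray_profile u \<sigma> r powr p) \<partial>?S)"
          using True by (intro nn_integral_cong) (simp add: ray_profile_def)
        then show ?thesis using True by (simp add: g_def ennreal_mult nn_integral_cmult)
      qed (simp add: g_def)
    qed
    finally show ?thesis by simp
  qed
  finally show ?thesis unfolding m_def .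
qed

text \<open>\<open>ray_maximal u \<sigma> r\<close> does not depend on \<open>s\<close>, so the
  pointwise bounds integrate over the sphere and survive the supremum over \<open>s\<close>.\<close>

lemma hardy_sup_bounds:
  fixes u :: "'a::euclidean_space \<Rightarrow> real"
  assumes u: "u \<in> test_functions_punctured" and p: "real DIM('a) < p"
  shows "hardy_sup_inner p u \<le> ennreal ((p / (p - real DIM('a))) powr p) * radial_energy p u"
    and "hardy_sup_outer p u \<le> ennreal ((p / (p - real DIM('a))) powr p) * radial_energy p u"
proof -
  have p0: "0 \<le> p" using p by linarith
  have "hardy_sup_inner p u \<le> (\<integral>\<^sup>+r. ennreal (r ^ (DIM('a) - 1)) * (\<integral>\<^sup>+\<sigma>. ennreal (ray_maximal u \<sigma> r powr p) \<partial>sphere_measure) * indicator {0<..} r \<partial>lborel)"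
    unfolding hardy_sup_inner_def
  proof (intro nn_integral_mono mult_right_mono mult_left_mono SUP_least)
    fix r s :: real and \<sigma> :: 'a
    assume "s \<in> {0<..r}" "\<sigma> \<in> space sphere_measure"
    then have "(\<bar>u (s *\<^sub>R \<sigma>)\<bar> / r) powr p \<le> ray_maximal u \<sigma> r powr p"
      by (intro powr_mono2 ray_maximal_bounds u p0) auto
    then show "ennreal (\<bar>u (s *\<^sub>R \<sigma>)\<bar> powr p / r powr p) \<le> ennreal (ray_maximal u \<sigma> r powr p)"
      using \<open>s \<in> {0<..r}\<close> by (intro ennreal_leI) (simp add: powr_divide)
  qed auto
  also note ray_maximal_energy[OF u p]
  finally show "hardy_sup_inner p u \<le> ennreal ((p / (p - real DIM('a))) powr p) * radial_energy p u" .
  have "hardy_sup_outer p u \<le> (\<integral>\<^sup>+r. ennreal (r ^ (DIM('a) - 1)) * (\<integral>\<^sup>+\<sigma>. ennreal (ray_maximal u \<sigma> r powr p) \<partial>sphere_measure) * indicator {0<..} r \<partial>lborel)"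
    unfolding hardy_sup_outer_def
  proof (rule nn_integral_mono)
    fix r :: real
    show "ennreal (r ^ (DIM('a) - 1)) * (SUP s\<in>{r..}. \<integral>\<^sup>+\<sigma>. ennreal (\<bar>u (s *\<^sub>R \<sigma>)\<bar> powr p / s powr p) \<partial>sphere_measure) * indicator {0<..} r
      \<le> ennreal (r ^ (DIM('a) - 1)) * (\<integral>\<^sup>+\<sigma>. ennreal (ray_maximal u \<sigma> r powr p) \<partial>sphere_measure) * indicator {0<..} r"
    \<comment> \<open>For \<open>r <= 0\<close> the range of \<open>s\<close> reaches nonpositive
      radii; the indicator discards this case. For the inner functional a point \<open>s\<close> of
      the index set already forces \<open>r > 0\<close>.\<close>
    proof (cases "0 < r")
      case r: True
      show ?thesis
      proof (intro nn_integral_mono mult_right_mono mult_left_mono SUP_least)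
        fix s :: real and \<sigma> :: 'a
        assume "s \<in> {r..}" "\<sigma> \<in> space sphere_measure"
        then have "(\<bar>u (s *\<^sub>R \<sigma>)\<bar> / s) powr p \<le> ray_maximal u \<sigma> r powr p"
          using r by (intro powr_mono2 ray_maximal_bounds u p0) auto
        then show "ennreal (\<bar>u (s *\<^sub>R \<sigma>)\<bar> powr p / s powr p) \<le> ennreal (ray_maximal u \<sigma> r powr p)"
          using \<open>s \<in> {r..}\<close> r by (intro ennreal_leI) (simp add: powr_divide)
      qed auto
    qed simp
  qed
  also note ray_maximal_energy[OF u p]
  finally show "hardy_sup_outer p u \<le> ennreal ((p / (p - real DIM('a))) powr p) * radial_energy p u" .
qed

subsection \<open>Smooth functions of the squared norm\<close>

text \<open>The product rule leaves undifferentiated factors, known to be regular of one order more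
  than its induction hypothesis asks for; this lowers the order.\<close>

lemma C_differentiable_Suc_imp: "C_differentiable (Suc k) f \<Longrightarrow> C_differentiable k f"
proof (induction k arbitrary: f)
  case 0
  then show ?case by (auto intro!: continuous_at_imp_continuous_on differentiable_imp_continuous_within)
next
  case (Suc k)
  have "C_differentiable (Suc k) (\<lambda>x. frechet_derivative f (at x) b)" if "b \<in> Basis" for b
    using Suc.prems that by (subst (asm) C_differentiable.simps(2)) blast
  then show ?case using Suc.IH Suc.prems by (auto simp del: C_differentiable.simps simp: C_differentiable.simps(2)[of k f] C_differentiable.simps(2)[of "Suc k" f])
qed

text \<open>By uniqueness of derivatives an explicit formula can stand in for
  \<open>frechet_derivative\<close>.\<close>

lemma C_differentiable_SucI:
  assumes "\<And>x. (f has_derivative D x) (at x)"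
    and "\<And>b. b \<in> Basis \<Longrightarrow> C_differentiable k (\<lambda>x. D x b)"
  shows "C_differentiable (Suc k) f"
proof -
  have "frechet_derivative f (at x) = D x" for x using assms(1) by (rule frechet_derivative_at[symmetric])
  then show ?thesis using assms by (auto simp: differentiable_def)
qed

lemma C_differentiable_SucD:
  assumes "C_differentiable (Suc k) f"
  shows "(f has_derivative frechet_derivative f (at x)) (at x)"
    and "b \<in> Basis \<Longrightarrow> C_differentiable k (\<lambda>x. frechet_derivative f (at x) b)"
  using assms by (auto simp: frechet_derivative_works[symmetric])

lemma C_differentiable_const: "C_differentiable k (\<lambda>_. c)"
proof (induction k arbitrary: c)
  case (Suc k)
  show ?case by (rule C_differentiable_SucI[where D="\<lambda>_ _. 0"]) (use Suc in auto)
qed simp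

lemma C_differentiable_inner: "C_differentiable k (\<lambda>x. c * (x \<bullet> b))"
proof (cases k)
  case (Suc j)
  show ?thesis unfolding Suc
    by (rule C_differentiable_SucI[where D="\<lambda>_ h. c * (h \<bullet> b)"]) (auto intro!: derivative_eq_intros C_differentiable_const)
qed (auto intro!: continuous_intros)

lemma C_differentiable_add:
  "C_differentiable k f \<Longrightarrow> C_differentiable k g \<Longrightarrow> C_differentiable k (\<lambda>x. f x + g x)"
proof (induction k arbitrary: f g)
  case (Suc k)
  note f = C_differentiable_SucD[OF Suc.prems(1)] and g = C_differentiable_SucD[OF Suc.prems(2)]
  show ?case
    by (rule C_differentiable_SucI[OF has_derivative_add[OF f(1) g(1)]]) (intro Suc.IH f(2) g(2))
qed (auto intro: continuous_intros)

lemma C_differentiable_mult: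
  "C_differentiable k f \<Longrightarrow> C_differentiable k g \<Longrightarrow> C_differentiable k (\<lambda>x. f x * g x)"
proof (induction k arbitrary: f g)
  case (Suc k)
  note f = C_differentiable_SucD[OF Suc.prems(1)] and g = C_differentiable_SucD[OF Suc.prems(2)]
  show ?case
    by (rule C_differentiable_SucI[OF has_derivative_mult[OF f(1) g(1)]])
      (intro C_differentiable_add Suc.IH f(2) g(2) Suc.prems[THEN C_differentiable_Suc_imp])
qed (auto intro: continuous_intros)

section \<open>Smooth functions on the line supported in \<open>[-1, 1]\<close>, and a bump
  function\<close>

definition flat_smooth :: "(real \<Rightarrow> real) \<Rightarrow> bool" where
  "flat_smooth f \<longleftrightarrow> (\<exists>D. D 0 = f \<and> (\<forall>k t. (D k has_real_derivative D (Suc k) t) (at t)) \<and> (\<forall>k t. 1 \<le> \<bar>t\<bar> \<longrightarrow> D k t = 0))"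

text \<open>\<open>flat_smooth\<close> carries the whole sequence of derivatives, so differentiation
  is a shift of that sequence.\<close>

lemma flat_smooth_deriv:
  assumes "flat_smooth f"
  obtains f' where "flat_smooth f'" "\<And>t. (f has_real_derivative f' t) (at t)"
proof -
  obtain D where D: "D 0 = f" "\<And>k t. (D k has_real_derivative D (Suc k) t) (at t)" "\<And>k t. 1 \<le> \<bar>t\<bar> \<Longrightarrow> D k t = 0"
    using assms unfolding flat_smooth_def by blast
  show thesis
  proof
    show "flat_smooth (D 1)" unfolding flat_smooth_def by (rule exI[of _ "\<lambda>k. D (Suc k)"]) (use D in auto)
    show "(f has_real_derivative D 1 t) (at t)" for t using D(1) D(2)[of 0 t] by simp
  qed
qed

lemma flat_smooth_lincomb:
  assumes "flat_smooth f" "flat_smooth g"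
  shows "flat_smooth (\<lambda>t. a * f t + b * g t)"
proof -
  obtain D E where D: "D 0 = f" "\<And>k t. (D k has_real_derivative D (Suc k) t) (at t)" "\<And>k t. 1 \<le> \<bar>t\<bar> \<Longrightarrow> D k t = 0"
    and E: "E 0 = g" "\<And>k t. (E k has_real_derivative E (Suc k) t) (at t)" "\<And>k t. 1 \<le> \<bar>t\<bar> \<Longrightarrow> E k t = 0"
    using assms unfolding flat_smooth_def by blast
  show ?thesis unfolding flat_smooth_def
    by (rule exI[of _ "\<lambda>k t. a * D k t + b * E k t"]) (use D E in \<open>auto intro!: derivative_intros DERIV_cmult\<close>)
qed

lemma flat_smooth_zero: "flat_smooth f \<Longrightarrow> 1 \<le> \<bar>t\<bar> \<Longrightarrow> f t = 0"
  unfolding flat_smooth_def by blast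

lemma flat_smooth_continuous: "flat_smooth f \<Longrightarrow> continuous_on UNIV f"
  by (metis flat_smooth_deriv DERIV_isCont continuous_at_imp_continuous_on)

text \<open>With \<open>s = 1 / (1 - t^2)\<close> the functions
  \<open>P(t) * s ^ m * exp (- s)\<close> form a family closed under differentiation;
  \<open>P = 1\<close> and \<open>m = 0\<close> give the classical bump function.\<close>

definition bump_term :: "real poly \<Rightarrow> nat \<Rightarrow> real \<Rightarrow> real" where
  "bump_term P m t = (if \<bar>t\<bar> < 1 then poly P t * ((1 / (1 - t\<^sup>2)) ^ m * exp (- (1 / (1 - t\<^sup>2)))) else 0)"

text \<open>The numerator of the derivative over the common power \<open>s ^ (m + 2)\<close>,
  obtained from \<open>s' = 2 * t * s^2\<close>; here \<open>[:1, 0, -1:]\<close> is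
  \<open>1 - t^2\<close>.\<close>

definition bump_next :: "real poly \<Rightarrow> nat \<Rightarrow> real poly" where
  "bump_next P m = pderiv P * [:1, 0, -1:]\<^sup>2 + smult (2 * real m) ([:0, 1:] * P * [:1, 0, -1:]) - smult 2 ([:0, 1:] * P)"

text \<open>A single term of the exponential series gives
  \<open>s ^ (m + 2) * exp (- s) <= fact (m + 2)\<close>, and the two extra powers of
  \<open>s\<close> are worth a factor \<open>(1 - t^2)^2\<close>. This quadratic vanishing yields
  derivative 0 at the endpoints in \<open>bump_term_deriv\<close>.\<close>

lemma bump_term_quadratic:
  obtains K where "\<And>t. \<bar>bump_term P m t\<bar> \<le> K * (1 - t\<^sup>2)\<^sup>2"
proof -
  have "compact (poly P ` {-1..1})" by (intro compact_continuous_image continuous_intros) auto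
  then have "bounded (poly P ` {-1..1})" by (rule compact_imp_bounded)
  then obtain B where "\<forall>y\<in>poly P ` {-1..1}. norm y \<le> B" unfolding bounded_iff by blast
  then have B: "\<bar>poly P t\<bar> \<le> B" if "t \<in> {-1..1}" for t using that by auto
  have B0: "0 \<le> B" using B[of 0] by auto
  show thesis
  proof
    fix t :: real
    show "\<bar>bump_term P m t\<bar> \<le> (B * fact (m + 2)) * (1 - t\<^sup>2)\<^sup>2"
    proof (cases "\<bar>t\<bar> < 1")
      case True
      define d where "d = 1 - t\<^sup>2"
      have d: "0 < d" using True by (simp add: d_def abs_square_less_1)
      define s where "s = 1 / d"
      have s: "0 < s" "s * d = 1" using d by (auto simp: s_def)
      have "s ^ (m + 2) / fact (m + 2) \<le> exp s"
      proof -
        have "(\<Sum>i\<in>{m + 2}. s ^ i / fact i) \<le> (\<Sum>i. s ^ i / fact i)"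
          using s summable_exp_generic[of s] by (intro sum_le_suminf) (auto simp: divide_inverse mult.commute)
        then show ?thesis by (simp add: exp_def divide_inverse mult.commute)
      qed
      then have "s ^ (m + 2) \<le> exp s * fact (m + 2)" by (subst (asm) pos_divide_le_eq) simp_all
      then have "s ^ (m + 2) * exp (- s) \<le> exp s * fact (m + 2) * exp (- s)"
        by (rule mult_right_mono) simp
      moreover have "exp s * fact (m + 2) * exp (- s) = fact (m + 2)" by (simp add: exp_minus)
      ultimately have le: "s ^ (m + 2) * exp (- s) \<le> fact (m + 2)" by (simp only:)
      have "s ^ (m + 2) * d\<^sup>2 = s ^ m * (s * d)\<^sup>2" by (simp only: power_add power_mult_distrib mult.assoc)
      then have "s ^ (m + 2) * d\<^sup>2 = s ^ m" unfolding s(2) by simp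
      then have eq: "s ^ m * exp (- s) = s ^ (m + 2) * exp (- s) * d\<^sup>2" by (metis (no_types) mult.assoc mult.commute)
      have le': "s ^ m * exp (- s) \<le> fact (m + 2) * d\<^sup>2"
        unfolding eq by (rule mult_right_mono[OF le]) simp
      have Bt: "\<bar>poly P t\<bar> \<le> B" by (rule B) (use True in \<open>auto simp: abs_less_iff\<close>)
      have main: "\<bar>poly P t\<bar> * (s ^ m * exp (- s)) \<le> B * (fact (m + 2) * d\<^sup>2)"
        by (rule mult_mono[OF Bt le']) (use B0 s in auto)
      have "bump_term P m t = poly P t * (s ^ m * exp (- s))"
        using True by (simp add: bump_term_def s_def d_def)
      then have "\<bar>bump_term P m t\<bar> = \<bar>poly P t\<bar> * (s ^ m * exp (- s))"
        using s by (simp add: abs_mult)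
      then show ?thesis using main by (simp only: mult.assoc d_def)
    qed (use B0 in \<open>simp add: bump_term_def\<close>)
  qed
qed

lemma bump_term_deriv: "(bump_term P m has_real_derivative bump_term (bump_next P m) (m + 2) t) (at t)"
proof -
  consider "\<bar>t\<bar> < 1" | "\<bar>t\<bar> = 1" | "1 < \<bar>t\<bar>" by linarith
  then show ?thesis
  proof cases
    case 1
    define d where "d = 1 - t\<^sup>2"
    have d: "0 < d" using 1 by (simp add: d_def abs_square_less_1)
    define s where "s = 1 / d"
    have sd: "s * d = 1" using d by (auto simp: s_def)
    have ds: "((\<lambda>t. 1 / (1 - t\<^sup>2)) has_real_derivative 2 * t * s\<^sup>2) (at t)"
      using d unfolding s_def d_def by (auto intro!: derivative_eq_intros simp: power2_eq_square field_simps)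
    have "((\<lambda>t. poly P t * ((1 / (1 - t\<^sup>2)) ^ m * exp (- (1 / (1 - t\<^sup>2))))) has_real_derivative
       poly (pderiv P) t * (s ^ m * exp (- s)) + (real m * (2 * t * s\<^sup>2 * s ^ (m - Suc 0)) * exp (- s) + exp (- s) * (- (2 * t * s\<^sup>2)) * s ^ m) * poly P t) (at t)"
      unfolding s_def d_def
      by (intro DERIV_mult poly_DERIV DERIV_power DERIV_fun_exp DERIV_minus ds[unfolded s_def d_def])
    also have "poly (pderiv P) t * (s ^ m * exp (- s)) + (real m * (2 * t * s\<^sup>2 * s ^ (m - Suc 0)) * exp (- s) + exp (- s) * (- (2 * t * s\<^sup>2)) * s ^ m) * poly P t
       = poly (bump_next P m) t * (s ^ (m + 2) * exp (- s))"
    proof -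
      have a: "s ^ (m + 2) * d\<^sup>2 = s ^ m"
      proof -
        have "s ^ (m + 2) * d\<^sup>2 = s ^ m * (s * d)\<^sup>2" by (simp only: power_add power_mult_distrib mult.assoc)
        then show ?thesis using sd by simp
      qed
      \<comment> \<open>For \<open>m = 0\<close> the truncated exponent is harmless because of the
        factor \<open>real m\<close>.\<close>
      have b: "real m * (s\<^sup>2 * s ^ (m - Suc 0)) = real m * (s ^ (m + 2) * d)"
      proof (cases m)
        case (Suc k)
        have "s ^ (m + 2) * d = s\<^sup>2 * s ^ k * (s * d)" by (simp add: Suc power2_eq_square mult_ac)
        then show ?thesis using sd Suc by (simp add: power2_eq_square)
      qed simp
      have n: "poly (bump_next P m) t = poly (pderiv P) t * d\<^sup>2 + 2 * real m * (t * poly P t * d) - 2 * (t * poly P t)"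
        by (simp add: bump_next_def d_def power2_eq_square algebra_simps)
      have "poly (bump_next P m) t * (s ^ (m + 2) * exp (- s))
        = poly (pderiv P) t * exp (- s) * (s ^ (m + 2) * d\<^sup>2) + 2 * t * poly P t * exp (- s) * (real m * (s ^ (m + 2) * d)) - 2 * t * poly P t * exp (- s) * s ^ (m + 2)"
        unfolding n by (simp add: algebra_simps)
      also have "\<dots> = poly (pderiv P) t * exp (- s) * s ^ m + 2 * t * poly P t * exp (- s) * (real m * (s\<^sup>2 * s ^ (m - Suc 0))) - 2 * t * poly P t * exp (- s) * (s ^ m * s\<^sup>2)"
        unfolding a b by (simp add: power_add power2_eq_square)
      finally show ?thesis by (simp add: algebra_simps)
    qed
    also have "\<dots> = bump_term (bump_next P m) (m + 2) t"
      using 1 by (simp add: bump_term_def s_def d_def)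
    finally show ?thesis
      by (rule has_field_derivative_transform_within_open[of _ _ _ "{-1<..<1}"]) (use 1 in \<open>auto simp: bump_term_def abs_less_iff\<close>)
  next
    case 2
    obtain K where K: "\<And>t. \<bar>bump_term P m t\<bar> \<le> K * (1 - t\<^sup>2)\<^sup>2" using bump_term_quadratic by blast
    have K0: "0 \<le> K" using K[of 0] by simp
    have t2: "t\<^sup>2 = 1" using 2 by (simp add: power2_eq_1_iff abs_if split: if_splits)
    have "((\<lambda>x. (bump_term P m x - bump_term P m t) / (x - t)) \<longlongrightarrow> 0) (at t)"
    proof (rule Lim_null_comparison)
      show "\<forall>\<^sub>F x in at t. norm ((bump_term P m x - bump_term P m t) / (x - t)) \<le> K * (\<bar>x - t\<bar> * (x + t)\<^sup>2)"
      proof (rule eventually_at_filter[THEN iffD2], rule always_eventually, intro allI impI)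
        fix x assume "x \<noteq> t"
        \<comment> \<open>As \<open>t^2 = 1\<close>, this factorisation makes the bound on
          \<open>bump_term\<close> quadratic in \<open>x - t\<close>, so the difference quotient
          tends to 0.\<close>
        have "1 - x\<^sup>2 = (t - x) * (t + x)" using t2 by (simp add: power2_eq_square algebra_simps)
        then have "(1 - x\<^sup>2)\<^sup>2 = \<bar>x - t\<bar> * \<bar>x - t\<bar> * (x + t)\<^sup>2"
          by (simp add: power_mult_distrib power2_commute[of t x] power2_eq_square[of "x - t"] add.commute)
        then have "\<bar>bump_term P m x\<bar> \<le> K * (\<bar>x - t\<bar> * (x + t)\<^sup>2) * \<bar>x - t\<bar>"
          using K[of x] by (simp add: mult_ac)
        moreover have "bump_term P m t = 0" using 2 by (simp add: bump_term_def)
        ultimately show "norm ((bump_term P m x - bump_term P m t) / (x - t)) \<le> K * (\<bar>x - t\<bar> * (x + t)\<^sup>2)"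
          using \<open>x \<noteq> t\<close> by (simp add: pos_divide_le_eq)
      qed
      show "((\<lambda>x. K * (\<bar>x - t\<bar> * (x + t)\<^sup>2)) \<longlongrightarrow> 0) (at t)"
        by (auto intro!: tendsto_eq_intros)
    qed
    moreover have "bump_term (bump_next P m) (m + 2) t = 0" using 2 by (simp add: bump_term_def)
    ultimately show ?thesis by (simp add: has_field_derivative_iff)
  next
    case 3
    have "((\<lambda>_. 0) has_real_derivative 0) (at t)" by simp
    then have "(bump_term P m has_real_derivative 0) (at t)"
      by (rule has_field_derivative_transform_within_open[of _ _ _ "{x. 1 < \<bar>x\<bar>}"])
        (use 3 in \<open>auto simp: bump_term_def intro!: open_Collect_less continuous_intros\<close>)
    then show ?thesis using 3 by (simp add: bump_term_def)
  qed
qed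

definition bump :: "real \<Rightarrow> real" where "bump = bump_term 1 0"

lemma flat_smooth_bump: "flat_smooth bump"
proof -
  define S where "S = rec_nat (1, 0) (\<lambda>_ (P, m). (bump_next P m, m + 2))"
  define D where "D k = bump_term (fst (S k)) (snd (S k))" for k
  have "(D k has_real_derivative D (Suc k) t) (at t)" for k t
    using bump_term_deriv[of "fst (S k)" "snd (S k)" t] by (simp add: D_def S_def split_def)
  moreover have "D 0 = bump" by (simp add: D_def S_def bump_def)
  moreover have "D k t = 0" if "1 \<le> \<bar>t\<bar>" for k t using that by (simp add: D_def bump_term_def)
  ultimately show ?thesis unfolding flat_smooth_def by blast
qed

lemma bump_pos: "\<bar>t\<bar> < 1 \<Longrightarrow> 0 < bump t"
  by (simp add: bump_def bump_term_def)

section \<open>Powers times a profile in the logarithmic variable\<close>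

definition log_profile :: "real \<Rightarrow> real \<Rightarrow> (real \<Rightarrow> real) \<Rightarrow> real \<Rightarrow> real" where
  "log_profile \<gamma> a f y = (if 0 < y then y powr \<gamma> * f (a * ln y) else 0)"

text \<open>The derivative is a \<open>log_profile\<close> again, which lets smoothness be proved by
  induction. The extension by 0 is smooth because \<open>f (a * ln y)\<close> already vanishes for
  \<open>0 < y < exp (- 1 / a)\<close>, so the function is zero near every
  \<open>y <= 0\<close>.\<close>

lemma log_profile_deriv:
  assumes a: "0 < a" and f: "flat_smooth f" and f': "\<And>t. (f has_real_derivative f' t) (at t)"
  shows "(log_profile \<gamma> a f has_real_derivative log_profile (\<gamma> - 1) a (\<lambda>t. \<gamma> * f t + a * f' t) y) (at y)"
proof (cases "0 < y")
  case True
  have "((\<lambda>y. y powr \<gamma> * f (a * ln y)) has_real_derivative \<gamma> * y powr (\<gamma> - 1) * f (a * ln y) + f' (a * ln y) * (a * (1 / y)) * y powr \<gamma>) (at y)"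
    using True by (intro DERIV_mult DERIV_chain2[OF f'] DERIV_cmult has_real_derivative_powr) (auto intro!: derivative_eq_intros)
  also have "\<gamma> * y powr (\<gamma> - 1) * f (a * ln y) + f' (a * ln y) * (a * (1 / y)) * y powr \<gamma> = log_profile (\<gamma> - 1) a (\<lambda>t. \<gamma> * f t + a * f' t) y"
    using True by (simp add: log_profile_def powr_diff field_simps)
  finally show ?thesis
    by (rule has_field_derivative_transform_within_open[of _ _ _ "{0<..}"]) (use True in \<open>auto simp: log_profile_def\<close>)
next
  case False
  have "((\<lambda>_. 0) has_real_derivative 0) (at y)" by simp
  then have "(log_profile \<gamma> a f has_real_derivative 0) (at y)"
  proof (rule has_field_derivative_transform_within_open[of _ _ _ "{..<exp (- 1 / a)}"])
    fix x assume x: "x \<in> {..<exp (- 1 / a)}"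
    show "0 = log_profile \<gamma> a f x"
    proof (cases "0 < x")
      case True
      then have "ln x < - 1 / a" using x by (metis exp_less_cancel_iff exp_ln lessThan_iff)
      then have "a * ln x < - 1" using a by (simp add: field_simps)
      then show ?thesis using flat_smooth_zero[OF f, of "a * ln x"] by (simp add: log_profile_def)
    qed (simp add: log_profile_def)
  qed (use False in \<open>auto intro: order.strict_trans1[OF _ exp_gt_zero]\<close>)
  then show ?thesis using False by (simp add: log_profile_def)
qed

lemma radial_has_derivative:
  fixes x :: "'a::euclidean_space"
  assumes "(F has_real_derivative F') (at (x \<bullet> x))"
  shows "((\<lambda>x. F (x \<bullet> x)) has_derivative (\<lambda>h. 2 * (x \<bullet> h) * F')) (at x)"
proof -
  have "((\<lambda>x. x \<bullet> x) has_derivative (\<lambda>h. x \<bullet> h + h \<bullet> x)) (at x)"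
    by (auto intro!: derivative_eq_intros)
  moreover have "(F has_derivative (\<lambda>h. h * F')) (at (x \<bullet> x))"
    using assms by (simp add: has_field_derivative_def mult_commute_abs)
  ultimately have "((\<lambda>x. F (x \<bullet> x)) has_derivative (\<lambda>h. (x \<bullet> h + h \<bullet> x) * F')) (at x)"
    by (rule has_derivative_compose)
  then show ?thesis by (simp add: inner_commute[of _ x])
qed

text \<open>Each partial derivative is a linear function times a \<open>log_profile\<close> with
  other parameters, so the induction ranges over all \<open>\<gamma>\<close> and \<open>f\<close>.
  Composing with \<open>x \<bullet> x\<close> rather than the norm keeps the inner function
  polynomial.\<close>

lemma C_differentiable_log_profile:
  assumes a: "0 < a" and "flat_smooth f"
  shows "C_differentiable k (\<lambda>x::'a::euclidean_space. log_profile \<gamma> a f (x \<bullet> x))"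
  using assms(2)
proof (induction k arbitrary: \<gamma> f)
  case (0 \<gamma> f)
  obtain f' where f': "\<And>t. (f has_real_derivative f' t) (at t)" using flat_smooth_deriv[OF 0] by metis
  have "isCont (\<lambda>x::'a. log_profile \<gamma> a f (x \<bullet> x)) x" for x
    by (rule has_derivative_continuous[OF radial_has_derivative[OF log_profile_deriv[OF a 0 f']]])
  then show ?case by (simp add: continuous_at_imp_continuous_on)
next
  case (Suc k \<gamma> f)
  obtain f' where f': "flat_smooth f'" "\<And>t. (f has_real_derivative f' t) (at t)" using flat_smooth_deriv[OF Suc.prems] by metis
  show ?case
  proof (rule C_differentiable_SucI[OF radial_has_derivative[OF log_profile_deriv[OF a Suc.prems f'(2)]]])
    fix b :: 'a
    show "C_differentiable k (\<lambda>x. 2 * (x \<bullet> b) * log_profile (\<gamma> - 1) a (\<lambda>t. \<gamma> * f t + a * f' t) (x \<bullet> x))"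
      by (intro C_differentiable_mult C_differentiable_inner Suc.IH flat_smooth_lincomb Suc.prems f')
  qed
qed

text \<open>A nonzero value forces \<open>a * ln (x \<bullet> x)\<close> into
  \<open>(-1, 1)\<close>, which confines the support to a closed annulus away from the
  origin.\<close>

lemma radial_test_function:
  assumes a: "0 < a" and f: "flat_smooth f"
  shows "(\<lambda>x::'a::euclidean_space. log_profile \<gamma> a f (x \<bullet> x)) \<in> test_functions_punctured"
proof -
  let ?u = "\<lambda>x::'a. log_profile \<gamma> a f (x \<bullet> x)"
  define A where "A = {x::'a. exp (- 1 / a) \<le> x \<bullet> x \<and> x \<bullet> x \<le> exp (1 / a)}"
  have "support_on UNIV ?u \<subseteq> A"
  proof
    fix x assume "x \<in> support_on UNIV ?u"
    then have nz: "log_profile \<gamma> a f (x \<bullet> x) \<noteq> 0" by (simp add: support_on_def)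
    then have pos: "0 < x \<bullet> x" by (auto simp: log_profile_def split: if_splits)
    have "\<bar>a * ln (x \<bullet> x)\<bar> < 1"
    proof (rule ccontr)
      assume "\<not> ?thesis"
      then have "f (a * ln (x \<bullet> x)) = 0" by (intro flat_smooth_zero[OF f]) simp
      then show False using nz pos by (simp add: log_profile_def)
    qed
    then have "- 1 / a \<le> ln (x \<bullet> x)" "ln (x \<bullet> x) \<le> 1 / a" using a by (auto simp: field_simps abs_less_iff)
    then have "exp (- 1 / a) \<le> exp (ln (x \<bullet> x))" "exp (ln (x \<bullet> x)) \<le> exp (1 / a)"
      by (simp_all only: exp_le_cancel_iff)
    then show "x \<in> A" unfolding A_def using pos by (simp only: exp_ln mem_Collect_eq simp_thms)
  qed
  moreover have "closed A" unfolding A_def by (intro closed_Collect_conj closed_Collect_le continuous_intros)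
  ultimately have cl: "closure (support_on UNIV ?u) \<subseteq> A" by (rule closure_minimal)
  have "bounded A" unfolding bounded_iff
  proof (rule exI[of _ "sqrt (exp (1 / a))"], rule ballI)
    fix x assume "x \<in> A"
    then show "norm x \<le> sqrt (exp (1 / a))" by (simp add: A_def norm_eq_sqrt_inner)
  qed
  then have "compact (closure (support_on UNIV ?u))"
    using cl bounded_subset compact_eq_bounded_closed by blast
  moreover have "0 \<notin> A" by (simp add: A_def not_le)
  ultimately show ?thesis using cl C_differentiable_log_profile[OF a f]
    by (auto simp: test_functions_punctured_def smooth_def)
qed

subsection \<open>Sharpness of the constant\<close>

text \<open>The map \<open>r -> \<epsilon> * ln r\<close> sends
  \<open>[exp (- 1 / \<epsilon>), exp (1 / \<epsilon>)]\<close> onto \<open>[-1, 1]\<close> with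
  derivative \<open>\<epsilon> / r\<close>. Since \<open>h\<close> vanishes outside
  \<open>(-1, 1)\<close>, the substitution takes place on a compact interval.\<close>

lemma nn_integral_log_substitution:
  fixes h :: "real \<Rightarrow> ennreal"
  assumes [measurable]: "h \<in> borel_measurable borel" and h0: "\<And>t. 1 \<le> \<bar>t\<bar> \<Longrightarrow> h t = 0" and \<epsilon>: "0 < \<epsilon>"
  shows "(\<integral>\<^sup>+t. h t \<partial>lborel) = ennreal \<epsilon> * (\<integral>\<^sup>+r. ennreal (1 / r) * h (\<epsilon> * ln r) * indicator {0<..} r \<partial>lborel)"
proof -
  define a b where "a = exp (- 1 / \<epsilon>)" and "b = exp (1 / \<epsilon>)"
  have ab: "0 < a" "a < b" using \<epsilon> by (auto simp: a_def b_def)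
  have ends: "\<epsilon> * ln a = - 1" "\<epsilon> * ln b = 1" using \<epsilon> by (auto simp: a_def b_def)
  have out: "h (\<epsilon> * ln r) = 0" if "0 < r" "r \<notin> {a..b}" for r
  proof (rule h0)
    have "ln r < ln a \<or> ln b < ln r" using that ab by auto
    then have "\<epsilon> * ln r < \<epsilon> * ln a \<or> \<epsilon> * ln b < \<epsilon> * ln r" using \<epsilon> by auto
    then show "1 \<le> \<bar>\<epsilon> * ln r\<bar>" unfolding ends by linarith
  qed
  have "(\<integral>\<^sup>+t. h t \<partial>lborel) = (\<integral>\<^sup>+t. h t * indicator {\<epsilon> * ln a..\<epsilon> * ln b} t \<partial>lborel)"
    unfolding ends
  proof (rule nn_integral_cong)
    fix t :: real
    show "h t = h t * indicator {- 1..1} t"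
    proof (cases "1 \<le> \<bar>t\<bar>")
      case False
      then have "t \<in> {- 1..1}" by auto
      then show ?thesis by simp
    qed (simp add: h0)
  qed
  also have "\<dots> = (\<integral>\<^sup>+r. h (\<epsilon> * ln r) * ennreal (\<epsilon> / r) * indicator {a..b} r \<partial>lborel)"
  proof (rule nn_integral_substitution_aux)
    show "((\<lambda>r. \<epsilon> * ln r) has_real_derivative \<epsilon> / r) (at r)" if "r \<in> {a..b}" for r
      using that ab by (auto intro!: derivative_eq_intros)
    show "continuous_on {a..b} (\<lambda>r. \<epsilon> / r)" using ab by (intro continuous_intros) auto
  qed (use ab \<epsilon> in auto)
  also have "\<dots> = (\<integral>\<^sup>+r. ennreal \<epsilon> * (ennreal (1 / r) * h (\<epsilon> * ln r) * indicator {0<..} r) \<partial>lborel)"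
  proof (rule nn_integral_cong)
    fix r :: real
    show "h (\<epsilon> * ln r) * ennreal (\<epsilon> / r) * indicator {a..b} r = ennreal \<epsilon> * (ennreal (1 / r) * h (\<epsilon> * ln r) * indicator {0<..} r)"
    proof (cases "0 < r")
      case True
      have "ennreal (\<epsilon> / r) = ennreal \<epsilon> * ennreal (1 / r)"
        using True \<epsilon> by (subst ennreal_mult[symmetric]) auto
      then show ?thesis using True out[OF True] by (cases "r \<in> {a..b}") (auto simp: mult_ac)
    next
      case False
      then show ?thesis using ab by simp
    qed
  qed
  also have "\<dots> = ennreal \<epsilon> * (\<integral>\<^sup>+r. ennreal (1 / r) * h (\<epsilon> * ln r) * indicator {0<..} r \<partial>lborel)"
    by (rule nn_integral_cmult) measurable
  finally show ?thesis .
qed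

text \<open>Away from 0 this is \<open>|x|^\<beta> * f (\<epsilon> * ln |x|)\<close>, a pure power
  cut off slowly on the logarithmic scale. The halves compensate for the square in
  \<open>x \<bullet> x = |x|^2\<close>.\<close>

definition log_radial :: "real \<Rightarrow> real \<Rightarrow> (real \<Rightarrow> real) \<Rightarrow> 'a::euclidean_space \<Rightarrow> real" where
  "log_radial \<beta> \<epsilon> f x = log_profile (\<beta> / 2) (\<epsilon> / 2) f (x \<bullet> x)"

lemma log_profile_power2:
  assumes "0 < r"
  shows "log_profile \<gamma> (\<epsilon> / 2) f (r\<^sup>2) = r powr (2 * \<gamma>) * f (\<epsilon> * ln r)"
proof -
  have "r\<^sup>2 powr \<gamma> = r powr (2 * \<gamma>)" using assms by (simp add: powr_powr flip: powr_numeral)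
  then show ?thesis using assms by (simp add: log_profile_def ln_realpow)
qed

lemma log_radial_sphere:
  assumes "0 < r" "norm \<sigma> = 1"
  shows "log_radial \<beta> \<epsilon> f (r *\<^sub>R \<sigma>) = r powr \<beta> * f (\<epsilon> * ln r)"
proof -
  have "(r *\<^sub>R \<sigma>) \<bullet> (r *\<^sub>R \<sigma>) = r\<^sup>2" using assms by (simp add: dot_square_norm)
  then show ?thesis using log_profile_power2[OF assms(1), of "\<beta> / 2"] by (simp add: log_radial_def)
qed

text \<open>Differentiating \<open>x \<bullet> x\<close> in the direction \<open>\<sigma>\<close>
  gives \<open>2 * r\<close>, which cancels the halves and raises the exponent from
  \<open>\<beta> - 2\<close> to \<open>\<beta> - 1\<close>.\<close>

lemma log_radial_derivative_sphere:
  fixes \<sigma> :: "'a::euclidean_space"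
  assumes r: "0 < r" and \<sigma>: "norm \<sigma> = 1" and \<epsilon>: "0 < \<epsilon>" and f: "flat_smooth f"
    and f': "\<And>t. (f has_real_derivative f' t) (at t)"
  shows "((r *\<^sub>R \<sigma>) /\<^sub>R norm (r *\<^sub>R \<sigma>)) \<bullet> grad (log_radial \<beta> \<epsilon> f) (r *\<^sub>R \<sigma>)
    = r powr (\<beta> - 1) * (\<beta> * f (\<epsilon> * ln r) + \<epsilon> * f' (\<epsilon> * ln r))"
proof -
  define x where "x = r *\<^sub>R \<sigma>"
  define F where "F = log_profile (\<beta> / 2 - 1) (\<epsilon> / 2) (\<lambda>t. \<beta> / 2 * f t + \<epsilon> / 2 * f' t) (x \<bullet> x)"
  have x: "x /\<^sub>R norm x = \<sigma>" "x \<bullet> \<sigma> = r" "x \<bullet> x = r\<^sup>2" using r \<sigma> by (simp_all add: x_def dot_square_norm)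
  have der: "(log_radial \<beta> \<epsilon> f has_derivative (\<lambda>h. 2 * (x \<bullet> h) * F)) (at x)"
    unfolding log_radial_def[abs_def] F_def
    by (rule radial_has_derivative, rule log_profile_deriv) (use \<epsilon> f f' in auto)
  have "\<sigma> \<bullet> grad (log_radial \<beta> \<epsilon> f) x = 2 * r * F"
    using der by (subst inner_grad) (auto simp: differentiable_def frechet_derivative_at[OF der, symmetric] x)
  also have "F = r powr (\<beta> - 2) * ((\<beta> * f (\<epsilon> * ln r) + \<epsilon> * f' (\<epsilon> * ln r)) / 2)"
    unfolding F_def x log_profile_power2[OF r] by (simp add: right_diff_distrib add_divide_distrib)
  also have "2 * r * \<dots> = (r * r powr (\<beta> - 2)) * (\<beta> * f (\<epsilon> * ln r) + \<epsilon> * f' (\<epsilon> * ln r))" by simp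
  also have "r * r powr (\<beta> - 2) = r powr (\<beta> - 1)"
    using r powr_add[of r 1 "\<beta> - 2"] by simp
  finally show ?thesis using x(1) by (simp only: x_def)
qed

lemma log_radial_test_function:
  assumes "0 < \<epsilon>" "flat_smooth f"
  shows "log_radial \<beta> \<epsilon> f \<in> (test_functions_punctured :: ('a::euclidean_space \<Rightarrow> real) set)"
  unfolding log_radial_def[abs_def] by (rule radial_test_function) (use assms in auto)

text \<open>The polar weight times a power of degree minus the dimension is the scale-invariant
  density \<open>1 / r\<close>.\<close>

lemma power_mult_powr_minus:
  fixes r :: real
  assumes "0 < r" "0 < n"
  shows "r ^ (n - 1) * r powr (- real n) = 1 / r"
proof -
  have "r powr (- real n) = inverse (r ^ n)" using assms by (simp add: powr_minus powr_realpow)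
  then show ?thesis using assms by (cases n) (auto simp: field_simps)
qed

section \<open>Both sides of the inequality for the logarithmic test functions\<close>

context
  fixes p :: real and \<beta> \<epsilon> :: real and f f' :: "real \<Rightarrow> real" and W :: ennreal
  assumes p: "real DIM('a::euclidean_space) < p"
    and \<epsilon>: "0 < \<epsilon>" and f: "flat_smooth f" and f': "\<And>t. (f has_real_derivative f' t) (at t)" and flat_f': "flat_smooth f'"
  defines "\<beta> \<equiv> (p - real DIM('a)) / p"
    and "W \<equiv> emeasure (sphere_measure :: 'a measure) (sphere 0 1)"
begin

text \<open>The supremum is bounded below by its value at \<open>s = r\<close>. By the choice of
  \<open>\<beta>\<close> the exponent \<open>\<beta> * p - p\<close> is minus the dimension, so the
  powers of \<open>r\<close> combine to \<open>1 / r\<close>.\<close>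

lemma log_radial_inner_ge:
  "W * (\<integral>\<^sup>+r. ennreal (1 / r) * ennreal (\<bar>f (\<epsilon> * ln r)\<bar> powr p) * indicator {0<..} r \<partial>lborel)
    \<le> hardy_sup_inner p (log_radial \<beta> \<epsilon> f :: 'a \<Rightarrow> real)"
proof -
  have p0: "0 < p" using p by linarith
  have [measurable]: "f \<in> borel_measurable borel"
    by (rule borel_measurable_continuous_onI[OF flat_smooth_continuous[OF f]])
  have "W * (\<integral>\<^sup>+r. ennreal (1 / r) * ennreal (\<bar>f (\<epsilon> * ln r)\<bar> powr p) * indicator {0<..} r \<partial>lborel)
    = (\<integral>\<^sup>+r. W * (ennreal (1 / r) * ennreal (\<bar>f (\<epsilon> * ln r)\<bar> powr p) * indicator {0<..} r) \<partial>lborel)"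
    by (rule nn_integral_cmult[symmetric]) measurable
  also have "\<dots> \<le> hardy_sup_inner p (log_radial \<beta> \<epsilon> f :: 'a \<Rightarrow> real)"
    unfolding hardy_sup_inner_def
  proof (rule nn_integral_mono)
    fix r :: real
    let ?w = "\<bar>f (\<epsilon> * ln r)\<bar> powr p"
    let ?I = "\<lambda>s. \<integral>\<^sup>+\<sigma>. ennreal (\<bar>log_radial \<beta> \<epsilon> f (s *\<^sub>R \<sigma> :: 'a)\<bar> powr p / r powr p) \<partial>sphere_measure"
    show "W * (ennreal (1 / r) * ennreal ?w * indicator {0<..} r)
      \<le> ennreal (r ^ (DIM('a) - 1)) * (SUP s\<in>{0<..r}. ?I s) * indicator {0<..} r"
    proof (cases "0 < r")
      case r: True
      have "(\<bar>r powr \<beta> * f (\<epsilon> * ln r)\<bar> powr p) / r powr p = r powr (\<beta> * p - p) * ?w"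
        using r by (simp add: abs_mult powr_mult powr_powr powr_diff)
      also have "\<beta> * p - p = - real DIM('a)" using p0 by (simp add: \<beta>_def)
      finally have val: "(\<bar>r powr \<beta> * f (\<epsilon> * ln r)\<bar> powr p) / r powr p = r powr (- real DIM('a)) * ?w" .
      have "?I r = (\<integral>\<^sup>+(\<sigma>::'a). ennreal (r powr (- real DIM('a)) * ?w) \<partial>sphere_measure)"
        using r by (intro nn_integral_cong) (simp add: log_radial_sphere val)
      also have "\<dots> = ennreal (r powr (- real DIM('a)) * ?w) * W" by (simp add: W_def)
      finally have I: "?I r = ennreal (r powr (- real DIM('a)) * ?w) * W" .
      have "r ^ (DIM('a) - 1) * (r powr (- real DIM('a)) * ?w) = 1 / r * ?w"
        using power_mult_powr_minus[OF r DIM_positive[where 'a='a]] by (simp only: mult.assoc[symmetric])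
      then have "ennreal (1 / r) * ennreal ?w = ennreal (r ^ (DIM('a) - 1)) * ennreal (r powr (- real DIM('a)) * ?w)"
        using r by (subst (1 2) ennreal_mult[symmetric]) auto
      then have "W * (ennreal (1 / r) * ennreal ?w) = ennreal (r ^ (DIM('a) - 1)) * ?I r"
        unfolding I by (simp add: mult_ac)
      also have "\<dots> \<le> ennreal (r ^ (DIM('a) - 1)) * (SUP s\<in>{0<..r}. ?I s)"
        by (intro mult_left_mono SUP_upper) (use r in auto)
      finally show ?thesis using r by simp
    qed simp
  qed
  finally show ?thesis .
qed

text \<open>Polar coordinates; \<open>(\<beta> - 1) * p\<close> is the same exponent as in
  \<open>log_radial_inner_ge\<close>, so both sides carry the weight \<open>1 / r\<close>.\<close>

lemma log_radial_energy:
  "radial_energy p (log_radial \<beta> \<epsilon> f :: 'a \<Rightarrow> real)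
    = W * (\<integral>\<^sup>+r. ennreal (1 / r) * ennreal (\<bar>\<beta> * f (\<epsilon> * ln r) + \<epsilon> * f' (\<epsilon> * ln r)\<bar> powr p) * indicator {0<..} r \<partial>lborel)"
proof -
  have p0: "0 < p" using p by linarith
  let ?u = "log_radial \<beta> \<epsilon> f :: 'a \<Rightarrow> real"
  have [measurable]: "f \<in> borel_measurable borel" "f' \<in> borel_measurable borel"
    by (rule borel_measurable_continuous_onI[OF flat_smooth_continuous], fact)+
  have "?u \<in> test_functions_punctured" by (rule log_radial_test_function[OF \<epsilon> f])
  then have "smooth ?u" by (simp add: test_functions_punctured_def)
  from continuous_on_grad[OF this] have [measurable]: "grad ?u \<in> borel_measurable borel" by (rule borel_measurable_continuous_onI)
  have "radial_energy p ?u = (\<integral>\<^sup>+r. ennreal (r ^ (DIM('a) - 1)) *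
      (\<integral>\<^sup>+\<sigma>. ennreal (\<bar>((r *\<^sub>R \<sigma>) /\<^sub>R norm (r *\<^sub>R \<sigma>)) \<bullet> grad ?u (r *\<^sub>R \<sigma>)\<bar> powr p) \<partial>sphere_measure) * indicator {0<..} r \<partial>lborel)"
    unfolding radial_energy_def by (rule nn_integral_polar) measurable
  also have "\<dots> = (\<integral>\<^sup>+r. W * (ennreal (1 / r) * ennreal (\<bar>\<beta> * f (\<epsilon> * ln r) + \<epsilon> * f' (\<epsilon> * ln r)\<bar> powr p) * indicator {0<..} r) \<partial>lborel)"
  proof (rule nn_integral_cong)
    fix r :: real
    let ?w = "\<bar>\<beta> * f (\<epsilon> * ln r) + \<epsilon> * f' (\<epsilon> * ln r)\<bar> powr p"
    let ?I = "\<integral>\<^sup>+\<sigma>. ennreal (\<bar>((r *\<^sub>R \<sigma>) /\<^sub>R norm (r *\<^sub>R \<sigma>)) \<bullet> grad ?u (r *\<^sub>R \<sigma>)\<bar> powr p) \<partial>sphere_measure"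
    show "ennreal (r ^ (DIM('a) - 1)) * ?I * indicator {0<..} r = W * (ennreal (1 / r) * ennreal ?w * indicator {0<..} r)"
    proof (cases "0 < r")
      case r: True
      have val: "\<bar>r powr (\<beta> - 1) * (\<beta> * f (\<epsilon> * ln r) + \<epsilon> * f' (\<epsilon> * ln r))\<bar> powr p = r powr (- real DIM('a)) * ?w"
      proof -
        have "\<bar>r powr (\<beta> - 1) * (\<beta> * f (\<epsilon> * ln r) + \<epsilon> * f' (\<epsilon> * ln r))\<bar> powr p = r powr ((\<beta> - 1) * p) * ?w"
          using r by (simp add: abs_mult powr_mult powr_powr)
        also have "(\<beta> - 1) * p = - real DIM('a)"
        proof -
          have "\<beta> * p = p - real DIM('a)" using p0 by (simp add: \<beta>_def)
          then show ?thesis by (simp add: left_diff_distrib)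
        qed
        finally show ?thesis .
      qed
      have "?I = (\<integral>\<^sup>+(\<sigma>::'a). ennreal (r powr (- real DIM('a)) * ?w) \<partial>sphere_measure)"
      proof (rule nn_integral_cong)
        fix \<sigma> :: 'a assume "\<sigma> \<in> space sphere_measure"
        then have "norm \<sigma> = 1" by simp
        from log_radial_derivative_sphere[OF r this \<epsilon> f f', of \<beta>]
        show "ennreal (\<bar>((r *\<^sub>R \<sigma>) /\<^sub>R norm (r *\<^sub>R \<sigma>)) \<bullet> grad ?u (r *\<^sub>R \<sigma>)\<bar> powr p) = ennreal (r powr (- real DIM('a)) * ?w)"
          by (simp only: val)
      qed
      also have "\<dots> = ennreal (r powr (- real DIM('a)) * ?w) * W" by (simp add: W_def)
      finally have I: "?I = ennreal (r powr (- real DIM('a)) * ?w) * W" .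
      have "r ^ (DIM('a) - 1) * (r powr (- real DIM('a)) * ?w) = 1 / r * ?w"
        using power_mult_powr_minus[OF r DIM_positive[where 'a='a]] by (simp only: mult.assoc[symmetric])
      then have "ennreal (1 / r) * ennreal ?w = ennreal (r ^ (DIM('a) - 1)) * ennreal (r powr (- real DIM('a)) * ?w)"
        using r by (subst (1 2) ennreal_mult[symmetric]) auto
      then have "W * (ennreal (1 / r) * ennreal ?w) = ennreal (r ^ (DIM('a) - 1)) * ?I"
        unfolding I by (simp add: mult_ac)
      then show ?thesis using r by simp
    qed simp
  qed
  also have "\<dots> = W * (\<integral>\<^sup>+r. ennreal (1 / r) * ennreal (\<bar>\<beta> * f (\<epsilon> * ln r) + \<epsilon> * f' (\<epsilon> * ln r)\<bar> powr p) * indicator {0<..} r \<partial>lborel)"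
    by (rule nn_integral_cmult) measurable
  finally show ?thesis .
qed

text \<open>The mass \<open>W\<close> is positive and finite, hence cancels, and the substitution
  \<open>t = \<epsilon> * ln r\<close> multiplies both sides by \<open>\<epsilon>\<close>. On the
  line \<open>\<epsilon>\<close> then survives only in front of \<open>f'\<close>.\<close>

lemma log_radial_transfer:
  assumes C: "hardy_sup_inner p (log_radial \<beta> \<epsilon> f :: 'a \<Rightarrow> real) \<le> C * radial_energy p (log_radial \<beta> \<epsilon> f :: 'a \<Rightarrow> real)"
  shows "(\<integral>\<^sup>+t. ennreal (\<bar>f t\<bar> powr p) \<partial>lborel) \<le> C * (\<integral>\<^sup>+t. ennreal (\<bar>\<beta> * f t + \<epsilon> * f' t\<bar> powr p) \<partial>lborel)"
proof -
  have p0: "0 < p" using p by linarith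
  have [measurable]: "f \<in> borel_measurable borel" "f' \<in> borel_measurable borel"
    by (rule borel_measurable_continuous_onI[OF flat_smooth_continuous], fact)+
  define X where "X = (\<integral>\<^sup>+r. ennreal (1 / r) * ennreal (\<bar>f (\<epsilon> * ln r)\<bar> powr p) * indicator {0<..} r \<partial>lborel)"
  define Y where "Y = (\<integral>\<^sup>+r. ennreal (1 / r) * ennreal (\<bar>\<beta> * f (\<epsilon> * ln r) + \<epsilon> * f' (\<epsilon> * ln r)\<bar> powr p) * indicator {0<..} r \<partial>lborel)"
  have "W * X \<le> C * (W * Y)"
    using log_radial_inner_ge C unfolding log_radial_energy X_def Y_def by (rule order_trans)
  then have "W * X \<le> W * (C * Y)" by (simp add: mult_ac)
  then have XY: "X \<le> C * Y"
    using sphere_measure_pos[where 'a='a] sphere_measure_finite[where 'a='a]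
    by (subst (asm) ennreal_mult_le_mult_iff) (auto simp: W_def)
  have "(\<integral>\<^sup>+t. ennreal (\<bar>f t\<bar> powr p) \<partial>lborel) = ennreal \<epsilon> * X"
    unfolding X_def by (rule nn_integral_log_substitution) (use \<epsilon> p0 flat_smooth_zero[OF f] in auto)
  also have "\<dots> \<le> ennreal \<epsilon> * (C * Y)" by (intro mult_left_mono XY) simp
  also have "\<dots> = C * (ennreal \<epsilon> * Y)" by (simp add: mult_ac)
  also have "ennreal \<epsilon> * Y = (\<integral>\<^sup>+t. ennreal (\<bar>\<beta> * f t + \<epsilon> * f' t\<bar> powr p) \<partial>lborel)"
    unfolding Y_def by (rule nn_integral_log_substitution[symmetric]) (use \<epsilon> p0 flat_smooth_zero[OF f] flat_smooth_zero[OF flat_f'] in auto)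
  finally show ?thesis .
qed

end

section \<open>The limit of ever slower cut-offs\<close>

lemma flat_smooth_bounded:
  assumes f: "flat_smooth f"
  obtains B where "0 \<le> B" "\<And>t. \<bar>f t\<bar> \<le> B"
proof -
  have "compact (f ` {-1..1})"
    by (intro compact_continuous_image continuous_on_subset[OF flat_smooth_continuous[OF f]]) auto
  then have "bounded (f ` {-1..1})" by (rule compact_imp_bounded)
  then obtain B where B: "\<forall>y\<in>f ` {-1..1}. norm y \<le> B" unfolding bounded_iff by blast
  show thesis
  proof
    have "norm (f 0) \<le> B" using B by auto
    then show B0: "0 \<le> B" by (rule order_trans[OF norm_ge_zero])
    show "\<bar>f t\<bar> \<le> B" for t
    proof (cases "1 \<le> \<bar>t\<bar>")
      case True then show ?thesis using flat_smooth_zero[OF f] B0 by simp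
    next
      case False then have "t \<in> {-1..1}" by auto
      then show ?thesis using B by auto
    qed
  qed
qed

text \<open>Both bounds serve to divide by this integral in \<open>hardy_sup_inner_sharp\<close>. It
  is positive since \<open>bump\<close> is positive on an interval, and finite since
  \<open>bump\<close> is bounded with compact support.\<close>

lemma bump_powr_integral:
  assumes p: "0 < p"
  shows "0 < (\<integral>\<^sup>+t. ennreal (\<bar>bump t\<bar> powr p) \<partial>lborel)"
    and "(\<integral>\<^sup>+t. ennreal (\<bar>bump t\<bar> powr p) \<partial>lborel) < \<infinity>"
proof -
  have [measurable]: "bump \<in> borel_measurable borel"
    by (rule borel_measurable_continuous_onI[OF flat_smooth_continuous[OF flat_smooth_bump]])
  show "0 < (\<integral>\<^sup>+t. ennreal (\<bar>bump t\<bar> powr p) \<partial>lborel)"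
  proof (rule ccontr)
    assume "\<not> ?thesis"
    then have "AE t in lborel. ennreal (\<bar>bump t\<bar> powr p) = 0"
      by (subst (asm) not_gr_zero) (simp add: nn_integral_0_iff_AE)
    then have "AE t in lborel. t \<notin> {-1<..<1::real}"
    proof eventually_elim
      case (elim t)
      then show ?case using bump_pos[of t] by (auto simp: abs_less_iff)
    qed
    then have "{-1<..<1::real} \<in> null_sets lborel" by (subst AE_iff_null_sets) auto
    then show False by (simp add: null_sets_def)
  qed
  obtain B where B: "0 \<le> B" "\<And>t. \<bar>bump t\<bar> \<le> B" using flat_smooth_bounded[OF flat_smooth_bump] by blast
  have "(\<integral>\<^sup>+t. ennreal (\<bar>bump t\<bar> powr p) \<partial>lborel) \<le> (\<integral>\<^sup>+t. ennreal (B powr p) * indicator {-1..1::real} t \<partial>lborel)"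
  proof (rule nn_integral_mono)
    fix t
    show "ennreal (\<bar>bump t\<bar> powr p) \<le> ennreal (B powr p) * indicator {-1..1} t"
    proof (cases "1 \<le> \<bar>t\<bar>")
      case True then show ?thesis using flat_smooth_zero[OF flat_smooth_bump] p by simp
    next
      case False then have "t \<in> {-1..1}" by auto
      then show ?thesis using B p by (auto intro!: ennreal_leI powr_mono2)
    qed
  qed
  also have "\<dots> < \<infinity>" by (simp add: nn_integral_cmult ennreal_mult_less_top)
  finally show "(\<integral>\<^sup>+t. ennreal (\<bar>bump t\<bar> powr p) \<partial>lborel) < \<infinity>" .
qed

text \<open>Dominated convergence: \<open>inverse (real (Suc n))\<close> is at most 1, so
  \<open>(\<beta> * B + B') powr p\<close> on \<open>[-1, 1]\<close> is a majorant for all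
  \<open>n\<close>.\<close>

lemma perturbed_integral_tendsto:
  assumes p: "0 < p" and \<beta>: "0 < \<beta>" and f: "flat_smooth f" and f': "flat_smooth f'"
  shows "(\<lambda>n. \<integral>\<^sup>+t. ennreal (\<bar>\<beta> * f t + inverse (real (Suc n)) * f' t\<bar> powr p) \<partial>lborel)
    \<longlonglongrightarrow> ennreal (\<beta> powr p) * (\<integral>\<^sup>+t. ennreal (\<bar>f t\<bar> powr p) \<partial>lborel)"
proof -
  have [measurable]: "f \<in> borel_measurable borel" "f' \<in> borel_measurable borel"
    by (rule borel_measurable_continuous_onI[OF flat_smooth_continuous], fact)+
  obtain B where B: "0 \<le> B" "\<And>t. \<bar>f t\<bar> \<le> B" using flat_smooth_bounded[OF f] by blast
  obtain B' where B': "0 \<le> B'" "\<And>t. \<bar>f' t\<bar> \<le> B'" using flat_smooth_bounded[OF f'] by blast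
  have "(\<lambda>n. \<integral>\<^sup>+t. ennreal (\<bar>\<beta> * f t + inverse (real (Suc n)) * f' t\<bar> powr p) \<partial>lborel)
    \<longlonglongrightarrow> (\<integral>\<^sup>+t. ennreal (\<bar>\<beta> * f t\<bar> powr p) \<partial>lborel)"
  proof (rule nn_integral_dominated_convergence[where w="\<lambda>t. ennreal ((\<beta> * B + B') powr p) * indicator {-1..1} t"])
    show "(\<integral>\<^sup>+t. ennreal ((\<beta> * B + B') powr p) * indicator {-1..1::real} t \<partial>lborel) < \<infinity>"
      by (simp add: nn_integral_cmult ennreal_mult_less_top)
    show "AE t in lborel. ennreal (\<bar>\<beta> * f t + inverse (real (Suc n)) * f' t\<bar> powr p) \<le> ennreal ((\<beta> * B + B') powr p) * indicator {-1..1} t" for n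
    proof (rule AE_I2)
      fix t :: real
      show "ennreal (\<bar>\<beta> * f t + inverse (real (Suc n)) * f' t\<bar> powr p) \<le> ennreal ((\<beta> * B + B') powr p) * indicator {-1..1} t"
      proof (cases "1 \<le> \<bar>t\<bar>")
        case True then show ?thesis using flat_smooth_zero[OF f] flat_smooth_zero[OF f'] p by simp
      next
        case False
        then have t: "t \<in> {-1..1}" by auto
        have "\<bar>\<beta> * f t + inverse (real (Suc n)) * f' t\<bar> \<le> \<bar>\<beta> * f t\<bar> + \<bar>inverse (real (Suc n)) * f' t\<bar>"
          by (rule abs_triangle_ineq)
        also have "\<bar>\<beta> * f t\<bar> \<le> \<beta> * B" using \<beta> B by (simp add: abs_mult)
        also have "\<bar>inverse (real (Suc n)) * f' t\<bar> \<le> 1 * B'"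
          unfolding abs_mult by (rule mult_mono) (use B' in \<open>auto simp: inverse_eq_divide\<close>)
        finally have "\<bar>\<beta> * f t + inverse (real (Suc n)) * f' t\<bar> powr p \<le> (\<beta> * B + B') powr p"
          using p by (intro powr_mono2) auto
        then show ?thesis using t by (simp add: ennreal_leI)
      qed
    qed
    show "AE t in lborel. (\<lambda>n. ennreal (\<bar>\<beta> * f t + inverse (real (Suc n)) * f' t\<bar> powr p)) \<longlonglongrightarrow> ennreal (\<bar>\<beta> * f t\<bar> powr p)"
    proof (rule AE_I2)
      fix t :: real
      have "(\<lambda>n. \<beta> * f t + inverse (real (Suc n)) * f' t) \<longlonglongrightarrow> \<beta> * f t + 0 * f' t"
        by (intro tendsto_intros LIMSEQ_inverse_real_of_nat)
      then have "(\<lambda>n. \<bar>\<beta> * f t + inverse (real (Suc n)) * f' t\<bar> powr p) \<longlonglongrightarrow> \<bar>\<beta> * f t + 0 * f' t\<bar> powr p"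
        by (intro tendsto_powr2 tendsto_rabs tendsto_const) (use p in auto)
      then show "(\<lambda>n. ennreal (\<bar>\<beta> * f t + inverse (real (Suc n)) * f' t\<bar> powr p)) \<longlonglongrightarrow> ennreal (\<bar>\<beta> * f t\<bar> powr p)"
        by (intro tendsto_ennrealI) simp
    qed
  qed measurable
  also have "(\<integral>\<^sup>+t. ennreal (\<bar>\<beta> * f t\<bar> powr p) \<partial>lborel) = (\<integral>\<^sup>+t. ennreal (\<beta> powr p) * ennreal (\<bar>f t\<bar> powr p) \<partial>lborel)"
  proof (rule nn_integral_cong)
    fix t
    have "\<bar>\<beta> * f t\<bar> powr p = \<beta> powr p * \<bar>f t\<bar> powr p" using \<beta> by (simp add: abs_mult powr_mult)
    then show "ennreal (\<bar>\<beta> * f t\<bar> powr p) = ennreal (\<beta> powr p) * ennreal (\<bar>f t\<bar> powr p)" by (simp add: ennreal_mult)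
  qed
  also have "\<dots> = ennreal (\<beta> powr p) * (\<integral>\<^sup>+t. ennreal (\<bar>f t\<bar> powr p) \<partial>lborel)"
    by (rule nn_integral_cmult) measurable
  finally show ?thesis .
qed

text \<open>For the bump with \<open>\<epsilon> = 1 / (n + 1)\<close> the transferred inequality
  tends to \<open>I <= C * \<beta> powr p * I\<close>. Dividing by \<open>I\<close>, which is
  neither 0 nor infinite, leaves \<open>C >= \<beta> powr (- p)\<close>, the asserted
  constant.\<close>

lemma hardy_sup_inner_sharp:
  fixes p :: real
  assumes p: "real DIM('a::euclidean_space) < p"
    and C: "\<And>u. u \<in> (test_functions_punctured :: ('a \<Rightarrow> real) set) \<Longrightarrow> hardy_sup_inner p u \<le> ennreal C * radial_energy p u"
  shows "(p / (p - real DIM('a))) powr p \<le> C"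
proof -
  define \<beta> where "\<beta> = (p - real DIM('a)) / p"
  have p0: "0 < p" using p by linarith
  have \<beta>: "0 < \<beta>" using p p0 by (simp add: \<beta>_def)
  obtain f' where f': "flat_smooth f'" "\<And>t. (bump has_real_derivative f' t) (at t)"
    using flat_smooth_deriv[OF flat_smooth_bump] by blast
  define I where "I = (\<integral>\<^sup>+t. ennreal (\<bar>bump t\<bar> powr p) \<partial>lborel)"
  have I: "I \<noteq> 0" "I \<noteq> top" using bump_powr_integral[OF p0] by (auto simp: I_def)
  have "I \<le> ennreal C * (\<integral>\<^sup>+t. ennreal (\<bar>\<beta> * bump t + inverse (real (Suc n)) * f' t\<bar> powr p) \<partial>lborel)" for n
    unfolding I_def \<beta>_def
  proof (rule log_radial_transfer[OF p])
    show "hardy_sup_inner p (log_radial ((p - real DIM('a)) / p) (inverse (real (Suc n))) bump :: 'a \<Rightarrow> real)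
      \<le> ennreal C * radial_energy p (log_radial ((p - real DIM('a)) / p) (inverse (real (Suc n))) bump :: 'a \<Rightarrow> real)"
      by (intro C log_radial_test_function flat_smooth_bump) simp
  qed (use f' flat_smooth_bump in auto)
  moreover have "(\<lambda>n. ennreal C * (\<integral>\<^sup>+t. ennreal (\<bar>\<beta> * bump t + inverse (real (Suc n)) * f' t\<bar> powr p) \<partial>lborel))
    \<longlonglongrightarrow> ennreal C * (ennreal (\<beta> powr p) * I)"
    unfolding I_def by (intro ennreal_tendsto_cmult perturbed_integral_tendsto p0 \<beta> flat_smooth_bump f') simp
  ultimately have "I \<le> ennreal C * (ennreal (\<beta> powr p) * I)" by (intro LIMSEQ_le_const) auto
  then have "I * 1 \<le> I * (ennreal C * ennreal (\<beta> powr p))" by (simp add: mult_ac)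
  then have one: "1 \<le> ennreal C * ennreal (\<beta> powr p)" using I by (subst (asm) ennreal_mult_le_mult_iff) auto
  \<comment> \<open>\<open>ennreal\<close> sends negative reals to 0, so the preceding inequality
    excludes \<open>C <= 0\<close>; after that it can be read in the reals.\<close>
  have C0: "0 < C"
  proof (rule ccontr)
    assume "\<not> 0 < C"
    then show False using one by (simp add: ennreal_neg)
  qed
  have "1 \<le> C * \<beta> powr p" using one C0 by (simp flip: ennreal_mult add: ennreal_1[symmetric] del: ennreal_1)
  then have "inverse (\<beta> powr p) \<le> C" using \<beta> by (simp add: field_simps)
  moreover have "(p / (p - real DIM('a))) powr p = inverse (\<beta> powr p)"
    using p p0 by (simp add: \<beta>_def powr_divide)
  ultimately show ?thesis by simp
qed

theorem theorem4p2:
  fixes p :: real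
  assumes "real DIM('a::euclidean_space) < p"
  shows "(\<forall>u \<in> (test_functions_punctured :: ('a \<Rightarrow> real) set).
            max (hardy_sup_inner p u) (hardy_sup_outer p u)
              \<le> ennreal (\<bar>p / (real DIM('a) - p)\<bar> powr p) * radial_energy p u)
       \<and> (\<forall>C::real. C < \<bar>p / (real DIM('a) - p)\<bar> powr p \<longrightarrow>
            \<not> (\<forall>u \<in> (test_functions_punctured :: ('a \<Rightarrow> real) set).
                  max (hardy_sup_inner p u) (hardy_sup_outer p u)
                    \<le> ennreal C * radial_energy p u))"
proof -
  have K: "\<bar>p / (real DIM('a) - p)\<bar> = p / (p - real DIM('a))"
  proof -
    have "p / (real DIM('a) - p) = - (p / (p - real DIM('a)))" by (simp add: minus_divide_right)
    then show ?thesis using assms by simp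
  qed
  \<comment> \<open>An inequality for the maximum restricts to the inner functional, so
    \<open>hardy_sup_inner_sharp\<close> bounds every admissible \<open>C\<close> from
    below.\<close>
  show ?thesis
    unfolding K using hardy_sup_bounds[OF _ assms] hardy_sup_inner_sharp[OF assms] by (fastforce simp: not_le[symmetric])
qed

end
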